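(* Let $\Omega\subset\mathbb H$ be an axially symmetric domain and let $Z\subset\Omega$ be a discrete (closed in $\Omega$) set consisting of points and spheres $x_0+y_0\mathbb S$, written as $Z=\mathcal S\cup\mathcal X\cup\mathcal Z$, where $\mathcal S=\{S_j=a_j+r_j\mathbb S\}$ is a set of spheres ($r_j>0$), $\mathcal X=\{x_l\}\subset\mathbb R$ is a set of real points, and $\mathcal Z=\{z_k\}\subset\mathbb H\setminus\mathbb R$ is a set of nonreal points such that each sphere $x+y\mathbb S$ contains at most one point of $\mathcal Z$. Suppose that: for each real point $x_l$ and each point $z_k\in\mathcal Z$ not lying on a sphere of $\mathcal S$, a finite jet (finitely many Taylor coefficients) is prescribed; for each sphere $S_j$, if $S_j$ contains a point $z_j'\in\mathcal Z$ a finite spherical jet at $z_j'$ is prescribed, and otherwise a finite spherical jet on the sphere $S_j$ is prescribed. Then there exists $f\in\mathcal{SR}(\Omega)$ having all the prescribed jets.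
   Context: $\mathbb H$ quaternions, $\mathbb S=\{I\in\mathbb H:I^2=-1\}$. A set $E$ is axially symmetric if $x+Iy\in E$ implies $x+Jy\in E$ for all $J\in\mathbb S$; axially symmetric domain = connected axially symmetric open set. Slice-regular functions $\mathcal{SR}(\Omega)$: $f(x+Jy)=F_1(x+iy)+JF_2(x+iy)$ with $F=F_1+\mathbf iF_2:\Omega\cap\mathbb C\to\mathbb H\otimes\mathbb C$ holomorphic, $F_1(\bar z)=F_1(z)$, $F_2(\bar z)=-F_2(z)$; $*$ denotes the product induced by multiplying stem functions, and $(q-q_0)^{*n}$ the $n$-th $*$-power. Jets at a point: near $q_0\in\Omega$, $f(q)=\sum_{n\ge0}(q-q_0)^{*n}A_n$ with $A_n=f^{(n)}(q_0)/n!$ (slice derivatives); a jet of order $l$ at $q_0$ is the prescription of $A_0,\dots,A_l\in\mathbb H$. Spherical jets: if $q_0\in x_0+y_0\mathbb S$, $f$ has an expansion $f(q)=\sum_{n\ge0}[(q-x_0)^2+y_0^2]^n[A_{2n}+(q-q_0)A_{2n+1}]$ near the sphere; a spherical jet of order $2l+1$ at $q_0$ is the prescription of $A_0,\dots,A_{2l+1}$; a spherical jet of order $2l+1$ on the sphere $x_0+y_0\mathbb S$ (no point specified) is a prescription $A_0,\dots,A_{2l+1}$ with $A_k=0$ for all odd $k$. *)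

theory Defs
  imports "HOL-Complex_Analysis.Complex_Analysis"
begin

section \<open>Quaternions, modelled as real^4 (components 1,2,3,4 = real, i, j, k parts)\<close>

type_synonym quat = "real^4"

definition qreal :: "real \<Rightarrow> quat" where
  "qreal r = vector [r, 0, 0, 0]"

definition qi :: quat where
  "qi = vector [0, 1, 0, 0]"

definition qmul :: "quat \<Rightarrow> quat \<Rightarrow> quat" (infixl "\<star>" 70) where
  "qmul p q = (\<chi> k::4.
     if k = 1 then (vec_nth p 1)*(vec_nth q 1) - (vec_nth p 2)*(vec_nth q 2) - (vec_nth p 3)*(vec_nth q 3) - (vec_nth p 4)*(vec_nth q 4)
     else if k = 2 then (vec_nth p 1)*(vec_nth q 2) + (vec_nth p 2)*(vec_nth q 1) + (vec_nth p 3)*(vec_nth q 4) - (vec_nth p 4)*(vec_nth q 3)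
     else if k = 3 then (vec_nth p 1)*(vec_nth q 3) - (vec_nth p 2)*(vec_nth q 4) + (vec_nth p 3)*(vec_nth q 1) + (vec_nth p 4)*(vec_nth q 2)
     else (vec_nth p 1)*(vec_nth q 4) + (vec_nth p 2)*(vec_nth q 3) - (vec_nth p 3)*(vec_nth q 2) + (vec_nth p 4)*(vec_nth q 1))"

primrec qpow :: "quat \<Rightarrow> nat \<Rightarrow> quat" where
  "qpow q 0 = qreal 1"
| "qpow q (Suc n) = q \<star> qpow q n"

definition qre :: "quat \<Rightarrow> real" where "qre q = (vec_nth q 1)"
definition qim :: "quat \<Rightarrow> quat" where "qim q = q - qreal ((vec_nth q 1))"

definition sphS :: "quat set" where
  "sphS = {I. I \<star> I = - qreal 1}"

definition qsphere :: "real \<Rightarrow> real \<Rightarrow> quat set" where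
  "qsphere x y = {qreal x + y *\<^sub>R J | J. J \<in> sphS}"

definition qcx :: "complex \<Rightarrow> quat" where
  "qcx z = qreal (Re z) + Im z *\<^sub>R qi"

definition axially_symmetric :: "quat set \<Rightarrow> bool" where
  "axially_symmetric E \<longleftrightarrow>
     (\<forall>x y I J. I \<in> sphS \<longrightarrow> J \<in> sphS \<longrightarrow> qreal x + y *\<^sub>R I \<in> E \<longrightarrow> qreal x + y *\<^sub>R J \<in> E)"

definition axially_symmetric_domain :: "quat set \<Rightarrow> bool" where
  "axially_symmetric_domain \<Omega> \<longleftrightarrow> open \<Omega> \<and> connected \<Omega> \<and> axially_symmetric \<Omega>"

text \<open>A stem function F = F1 + i F2 with values in H \<otimes> C, where H \<otimes> C = C^4
  componentwise: F is holomorphic iff each component F1$m + i F2$m is holomorphic.\<close>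
definition slice_regular :: "quat set \<Rightarrow> (quat \<Rightarrow> quat) \<Rightarrow> bool" where
  "slice_regular \<Omega> f \<longleftrightarrow>
     (\<exists>F1 F2 :: complex \<Rightarrow> quat.
        (\<forall>m::4. (\<lambda>z. Complex (vec_nth (F1 z) m) (vec_nth (F2 z) m)) holomorphic_on {z. qcx z \<in> \<Omega>}) \<and>
        (\<forall>z. qcx z \<in> \<Omega> \<longrightarrow> F1 (cnj z) = F1 z \<and> F2 (cnj z) = - F2 z) \<and>
        (\<forall>x y J. J \<in> sphS \<longrightarrow> qreal x + y *\<^sub>R J \<in> \<Omega> \<longrightarrow>
             f (qreal x + y *\<^sub>R J) = F1 (Complex x y) + J \<star> F2 (Complex x y)))"

text \<open>Slice derivative: for slice-regular f it equals the derivative in the real direction.\<close>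
definition sderiv :: "(quat \<Rightarrow> quat) \<Rightarrow> quat \<Rightarrow> quat" where
  "sderiv f q = vector_derivative (\<lambda>t::real. f (q + qreal t)) (at 0)"

definition has_jet :: "(quat \<Rightarrow> quat) \<Rightarrow> quat \<Rightarrow> nat \<Rightarrow> (nat \<Rightarrow> quat) \<Rightarrow> bool" where
  "has_jet f q0 l A \<longleftrightarrow> (\<forall>n\<le>l. A n = (1 / fact n) *\<^sub>R ((sderiv ^^ n) f q0))"

definition has_sph_jet ::
  "quat set \<Rightarrow> (quat \<Rightarrow> quat) \<Rightarrow> quat \<Rightarrow> nat \<Rightarrow> (nat \<Rightarrow> quat) \<Rightarrow> bool" where
  "has_sph_jet \<Omega> f q0 l A \<longleftrightarrow>
     (\<exists>U B. open U \<and> qsphere (qre q0) (norm (qim q0)) \<subseteq> U \<and> U \<subseteq> \<Omega> \<and>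
        (\<forall>k\<le>2*l+1. B k = A k) \<and>
        (\<forall>q\<in>U. (\<lambda>n. qpow ((q - qreal (qre q0)) \<star> (q - qreal (qre q0)) + qreal ((norm (qim q0))\<^sup>2)) n
                     \<star> (B (2*n) + (q - q0) \<star> B (2*n+1))) sums f q))"

end

(*
  A slice-regular function is given by four holomorphic functions G m on the open set
  D = {z. qcx z in Omega} with G m (cnj z) = cnj (G m z), and every prescribed jet is a condition on
  the jet of each G m at one point of the closed upper half plane: a point jet asks for the derivatives
  n! A_n $ m, a spherical jet asks that G m agree to order l + 1 at a + i r with the polynomial
  sum_n s^n (alpha_n + z beta_n), s = (z - a)^2 + r^2, since a function divisible by s^(l+1) only has
  later terms in its expansion in powers of s.

  Jets at a locally finite set of points of D are interpolated by a series of corrections, each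
  vanishing at the earlier points and multiplied by a high power of z or of 1 / (z - b), b a boundary
  point, which makes it small on large compact sets. Averaging f with cnj o f o cnj yields the symmetry.
*)

theory Submission
  imports Defs
begin

subsection \<open>Zeros of finite order and locally finite sets\<close>

text \<open>The four components can be handled one at a time because coefficients stand on the
  right: for \<open>q = x + y J\<close>, left multiplication by an element of the plane of
  \<open>J\<close> multiplies every complex component by the same number. The centre
  \<open>q0\<close> of a spherical jet is harmless as well, since A + (q - q0) B = (A - q0 B) + q B;
  so alpha_n and beta_n are the real components of
  \<open>A (2 * n) - q0 \<star> A (2 * n + 1)\<close> and \<open>A (2 * n + 1)\<close>.

  At a nonreal point a point jet constrains only F1 + J F2, half of the real parameters of the stem
  jet. The freedom is spent on asking for real derivatives, so that F2 contributes nothing and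
  \<open>J\<close> drops out.

  Conjugation symmetry ties the jet at a point to the jet at its conjugate. Hence every prescription
  is moved to a single point of the closed upper half plane: for a sphere, agreement at a + i r
  forces agreement at a - i r because the target polynomial has real coefficients. At a real point
  the target must itself be symmetric, or averaging would destroy it; real Taylor coefficients
  ensure this.\<close>

definition vanishes_to :: "complex set \<Rightarrow> complex \<Rightarrow> nat \<Rightarrow> (complex \<Rightarrow> complex) \<Rightarrow> bool" where
  "vanishes_to D p m f \<longleftrightarrow> (\<exists>k. k holomorphic_on D \<and> (\<forall>z\<in>D. f z = (z - p) ^ m * k z))"

lemma vanishes_to_cong:
  assumes "vanishes_to D p m f" "\<And>z. z \<in> D \<Longrightarrow> f z = g z"
  shows "vanishes_to D p m g"
  using assms unfolding vanishes_to_def by auto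

lemma vanishes_to_add:
  assumes "vanishes_to D p m f" "vanishes_to D p m g"
  shows "vanishes_to D p m (\<lambda>z. f z + g z)"
proof -
  obtain k l where "k holomorphic_on D" "\<And>z. z \<in> D \<Longrightarrow> f z = (z - p) ^ m * k z"
    and "l holomorphic_on D" "\<And>z. z \<in> D \<Longrightarrow> g z = (z - p) ^ m * l z"
    using assms unfolding vanishes_to_def by blast
  then show ?thesis
    unfolding vanishes_to_def
    by (intro exI[of _ "\<lambda>z. k z + l z"]) (auto intro!: holomorphic_intros simp: algebra_simps)
qed

lemma vanishes_to_mult:
  assumes "vanishes_to D p m f" "g holomorphic_on D"
  shows "vanishes_to D p m (\<lambda>z. g z * f z)"
proof -
  obtain k where "k holomorphic_on D" "\<And>z. z \<in> D \<Longrightarrow> f z = (z - p) ^ m * k z"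
    using assms unfolding vanishes_to_def by blast
  then show ?thesis
    unfolding vanishes_to_def using assms(2)
    by (intro exI[of _ "\<lambda>z. g z * k z"]) (auto intro!: holomorphic_intros simp: algebra_simps)
qed

text \<open>The difference quotient, completed by the derivative at \<open>p\<close>, has a
  removable singularity there.\<close>

lemma vanishes_to_1:
  assumes "open D" "f holomorphic_on D" "f p = 0"
  shows "vanishes_to D p 1 f"
  unfolding vanishes_to_def
proof (intro exI conjI ballI)
  have "(\<lambda>z. if z = p then deriv f p else f z / (z - p) - f p / (z - p)) holomorphic_on D"
    by (rule pole_theorem_open[OF assms(2,1)]) auto
  then show "(\<lambda>z. if z = p then deriv f p else f z / (z - p)) holomorphic_on D"
    using assms(3) by (simp cong: if_cong)
qed (auto simp: assms)

lemma vanishes_to_Suc: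
  assumes "open D" "k holomorphic_on D" "k p = 0" "\<And>z. z \<in> D \<Longrightarrow> f z = (z - p) ^ m * k z"
  shows "vanishes_to D p (Suc m) f"
proof -
  obtain l where "l holomorphic_on D" "\<And>z. z \<in> D \<Longrightarrow> k z = (z - p) ^ 1 * l z"
    using vanishes_to_1[OF assms(1-3)] unfolding vanishes_to_def by blast
  then show ?thesis
    unfolding vanishes_to_def using assms(4) by (intro exI[of _ l]) auto
qed

text \<open>In the Leibniz sum a term survives at \<open>p\<close> only if all \<open>m\<close>
  derivatives fall on the power, which for \<open>n \<le> m\<close> requires
  \<open>n = m\<close>.\<close>

lemma higher_deriv_power_mult:
  assumes "open D" "p \<in> D" "k holomorphic_on D" "n \<le> m"
  shows "(deriv ^^ n) (\<lambda>z. (z - p) ^ m * k z) p = (if n = m then fact m * k p else 0)"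
proof -
  have *: "(deriv ^^ i) (\<lambda>w. (w - p) ^ m) p = (if i = m then fact m else 0)" if "i \<le> m" for i
    using that unfolding higher_deriv_power by (auto simp: pochhammer_fact Suc_diff_le)
  have "(deriv ^^ n) (\<lambda>z. (z - p) ^ m * k z) p
      = (\<Sum>i = 0..n. of_nat (n choose i) * (deriv ^^ i) (\<lambda>z. (z - p) ^ m) p * (deriv ^^ (n - i)) k p)"
    by (rule higher_deriv_mult[OF _ assms(3,1,2)]) (intro holomorphic_intros)
  also have "\<dots> = (\<Sum>i = 0..n. if i = m then fact m * k p else 0)"
    using assms(4) by (intro sum.cong) (auto simp: *)
  also have "\<dots> = (if n = m then fact m * k p else 0)"
    using assms(4) by (subst sum.delta) auto
  finally show ?thesis .
qed

text \<open>Both descriptions are needed: divisibility with a cofactor on all of \<open>D\<close>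
  behaves well under sums and products, while derivatives pass to locally uniform limits. The
  induction strips off one factor at a time: the next derivative is \<open>fact m\<close> times the
  value of the cofactor at \<open>p\<close>.\<close>

lemma vanishes_to_iff_higher_deriv:
  assumes "open D" "p \<in> D" "f holomorphic_on D"
  shows "vanishes_to D p m f \<longleftrightarrow> (\<forall>n<m. (deriv ^^ n) f p = 0)"
proof (induction m)
  case 0
  show ?case using assms unfolding vanishes_to_def by auto
next
  case (Suc m)
  have eq: "(deriv ^^ n) f p = (deriv ^^ n) (\<lambda>z. (z - p) ^ j * k z) p"
    if "k holomorphic_on D" "\<forall>z\<in>D. f z = (z - p) ^ j * k z" for n j k
    by (rule higher_deriv_transform_within_open[OF assms(3) _ assms(1,2)])
       (use that in \<open>auto intro!: holomorphic_intros\<close>)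
  show ?case
  proof
    assume "vanishes_to D p (Suc m) f"
    then obtain k where k: "k holomorphic_on D" "\<forall>z\<in>D. f z = (z - p) ^ Suc m * k z"
      unfolding vanishes_to_def by blast
    show "\<forall>n<Suc m. (deriv ^^ n) f p = 0"
    proof (intro allI impI)
      fix n assume "n < Suc m"
      then show "(deriv ^^ n) f p = 0"
        unfolding eq[OF k] by (subst higher_deriv_power_mult[OF assms(1,2) k(1)]) auto
    qed
  next
    assume z: "\<forall>n<Suc m. (deriv ^^ n) f p = 0"
    then obtain k where k: "k holomorphic_on D" "\<forall>z\<in>D. f z = (z - p) ^ m * k z"
      using Suc unfolding vanishes_to_def by auto
    have "fact m * k p = 0"
      using eq[OF k, of m] higher_deriv_power_mult[OF assms(1,2) k(1), of m m] z by auto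
    then show "vanishes_to D p (Suc m) f"
      by (intro vanishes_to_Suc[OF assms(1) k(1)]) (use k in auto)
  qed
qed

text \<open>Discrete and closed in \<open>D\<close> at once, since the balls are also required about
  points of \<open>D\<close> outside \<open>P\<close>.\<close>

definition locally_finite_subset :: "'a::metric_space set \<Rightarrow> 'a set \<Rightarrow> bool" where
  "locally_finite_subset D P \<longleftrightarrow> P \<subseteq> D \<and> (\<forall>z\<in>D. \<exists>e>0. finite (P \<inter> ball z e))"

lemma locally_finite_subset_compact:
  assumes "locally_finite_subset D P" "compact K" "K \<subseteq> D"
  shows "finite (P \<inter> K)"
proof -
  obtain e where e: "\<And>z. z \<in> D \<Longrightarrow> e z > 0 \<and> finite (P \<inter> ball z (e z))"
    using assms(1) unfolding locally_finite_subset_def by metis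
  obtain C where C: "C \<subseteq> K" "finite C" "K \<subseteq> (\<Union>c\<in>C. ball c (e c))"
  proof (rule compactE_image[OF assms(2), of K "\<lambda>c. ball c (e c)"])
    show "K \<subseteq> (\<Union>c\<in>K. ball c (e c))" using e assms(3) by force
  qed auto
  have "finite (\<Union>c\<in>C. P \<inter> ball c (e c))"
    using C(1,2) e assms(3) by (intro finite_UN_I) auto
  then show ?thesis by (rule rev_finite_subset) (use C in auto)
qed

text \<open>The function \<open>\<phi>\<close> is \<open>z / p\<close> if \<open>p\<close> is large, and \<open>(p - b) / (z - b)\<close> with \<open>b\<close> a nearest
  boundary point if \<open>p\<close> is close to the boundary. Its high powers are small on the sublevel sets of \<open>h\<close>
  below \<open>h p\<close>, which replaces Runge's theorem.\<close>

lemma exhaustion_function: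
  assumes "open (D::complex set)"
  obtains h :: "complex \<Rightarrow> real" where "continuous_on D h" "\<And>z. z \<in> D \<Longrightarrow> h z \<ge> 1"
    "\<And>R. compact {z\<in>D. h z \<le> R}"
    "\<And>p. p \<in> D \<Longrightarrow> \<exists>\<phi>. \<phi> holomorphic_on D \<and> \<phi> p = 1 \<and> (\<forall>z\<in>D. norm (\<phi> z) \<le> h z / h p)"
proof (cases "D = UNIV")
  case True
  define h where "h = (\<lambda>z::complex. max 1 (norm z))"
  show ?thesis
  proof (rule that)
    show "continuous_on D h" unfolding h_def by (intro continuous_intros)
    show "h z \<ge> 1" for z by (simp add: h_def)
    show "compact {z\<in>D. h z \<le> R}" for R
    proof (cases "R \<ge> 1")
      case True
      then have "{z\<in>D. h z \<le> R} = cball 0 R" using \<open>D = UNIV\<close> by (auto simp: h_def)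
      then show ?thesis by simp
    next
      case False
      then have "{z\<in>D. h z \<le> R} = {}" by (auto simp: h_def)
      then show ?thesis by (metis compact_empty)
    qed
    show "\<exists>\<phi>. \<phi> holomorphic_on D \<and> \<phi> p = 1 \<and> (\<forall>z\<in>D. norm (\<phi> z) \<le> h z / h p)" for p
    proof (cases "norm p \<le> 1")
      case True
      then show ?thesis by (intro exI[of _ "\<lambda>_. 1"]) (auto simp: h_def)
    next
      case False
      then have "p \<noteq> 0" "h p = norm p" by (auto simp: h_def)
      then show ?thesis
        by (intro exI[of _ "\<lambda>z. z / p"])
           (auto simp: h_def norm_divide intro!: holomorphic_intros divide_right_mono)
    qed
  qed
next
  case False
  then have ne: "- D \<noteq> {}" by auto
  have cl: "closed (- D)" using assms by auto
  define d where "d = (\<lambda>z. infdist z (- D))"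
  have dpos: "d z > 0" if "z \<in> D" for z
    using infdist_pos_not_in_closed[OF cl ne] that by (simp add: d_def)
  define h where "h = (\<lambda>z::complex. max 1 (max (norm z) (1 / d z)))"
  show ?thesis
  proof (rule that)
    show "continuous_on D h" unfolding h_def d_def
      using less_imp_neq[OF dpos] by (intro continuous_intros) (auto simp: d_def)
    show "h z \<ge> 1" for z by (simp add: h_def)
    show "compact {z\<in>D. h z \<le> R}" for R
    proof (cases "R \<ge> 1")
      case True
      have "{z\<in>D. h z \<le> R} = cball 0 R \<inter> {z. d z \<ge> 1 / R}"
      proof (intro set_eqI iffI)
        fix z assume z: "z \<in> cball 0 R \<inter> {z. d z \<ge> 1 / R}"
        then have "d z > 0" using True by (auto intro: less_le_trans[of 0 "1/R"])
        then have "z \<in> D" unfolding d_def using infdist_zero[of z "- D"] by (metis ComplI less_irrefl)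
        then show "z \<in> {z\<in>D. h z \<le> R}"
          using z True \<open>d z > 0\<close> by (auto simp: h_def field_simps)
      next
        fix z assume "z \<in> {z\<in>D. h z \<le> R}"
        then show "z \<in> cball 0 R \<inter> {z. d z \<ge> 1 / R}"
          using dpos[of z] True by (auto simp: h_def field_simps)
      qed
      moreover have "closed {z. d z \<ge> 1 / R}"
        unfolding d_def by (intro closed_Collect_le continuous_intros)
      ultimately show ?thesis by (simp add: compact_Int_closed)
    next
      case False
      then have "{z\<in>D. h z \<le> R} = {}" by (auto simp: h_def)
      then show ?thesis by (metis compact_empty)
    qed
    show "\<exists>\<phi>. \<phi> holomorphic_on D \<and> \<phi> p = 1 \<and> (\<forall>z\<in>D. norm (\<phi> z) \<le> h z / h p)"
      if p: "p \<in> D" for p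
    proof -
      \<comment> \<open>Whichever term attains the maximum at \<open>p\<close> dictates \<phi>: the
        constant 1, which is admissible because \<open>h\<close> is at least 1 everywhere, then
        \<open>z / p\<close>, then the quotient with pole at a nearest boundary point.\<close>
      consider "h p = 1" | "h p = norm p" "norm p > 1" | "h p = 1 / d p"
        unfolding h_def by linarith
      then show ?thesis
      proof cases
        case 1
        then show ?thesis by (intro exI[of _ "\<lambda>_. 1"]) (auto simp: h_def)
      next
        case 2
        then have "p \<noteq> 0" by auto
        then show ?thesis using 2
          by (intro exI[of _ "\<lambda>z. z / p"])
             (auto simp: h_def norm_divide intro!: holomorphic_intros divide_right_mono)
      next
        case 3
        obtain b where b: "b \<in> - D" "d p = dist p b"
          using infdist_attains_inf[OF cl ne, of p] by (auto simp: d_def)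
        have db: "d z \<le> dist z b" for z unfolding d_def using b(1) by (rule infdist_le)
        have nb: "z \<noteq> b" if "z \<in> D" for z using b(1) that by auto
        have "norm ((p - b) / (z - b)) \<le> h z / h p" if z: "z \<in> D" for z
        proof -
          have "norm ((p - b) / (z - b)) = d p / dist z b" by (simp add: norm_divide b dist_norm)
          also have "\<dots> \<le> d p / d z"
            using db[of z] dpos[OF z] dpos[OF p] by (intro divide_left_mono mult_pos_pos) auto
          also have "\<dots> = (1 / d z) * d p" by simp
          also have "\<dots> \<le> h z * d p"
            using dpos[OF p] by (intro mult_right_mono) (auto simp: h_def)
          finally show ?thesis by (simp add: 3)
        qed
        moreover have "p \<noteq> b" using nb p by auto
        ultimately show ?thesis using nb
          by (intro exI[of _ "\<lambda>z. (p - b) / (z - b)"]) (auto intro!: holomorphic_intros)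
      qed
    qed
  qed
qed

subsection \<open>Interpolation of jets on an open set\<close>

text \<open>\<open>Q\<close> carries the zeros at the points already treated. The order of contact
  at \<open>p\<close> is raised by one per step, and each step adds a term containing
  \<open>\<phi> z ^ N\<close>: this factor equals 1 at \<open>p\<close>, so it does not disturb the
  coefficient to be cancelled, and a large \<open>N\<close> makes the term as small as desired on
  \<open>K\<close>. Half of \<epsilon> is reserved for the earlier steps.\<close>

lemma correction_step:
  assumes D: "open D" and p: "p \<in> D" and s: "s holomorphic_on D" and t: "t holomorphic_on D"
    and Q: "Q holomorphic_on D" "Q p \<noteq> 0"
    and \<phi>: "\<phi> holomorphic_on D" "\<phi> p = 1"
    and K: "compact K" "K \<subseteq> D" "\<And>z. z \<in> K \<Longrightarrow> norm (\<phi> z) \<le> 1 / 2"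
  shows "\<epsilon> > 0 \<Longrightarrow> \<exists>u. u holomorphic_on D \<and> vanishes_to D p m (\<lambda>z. s z + Q z * u z - t z) \<and>
           (\<forall>z\<in>K. norm (Q z * u z) \<le> \<epsilon>)"
proof (induction m arbitrary: \<epsilon>)
  case 0
  have "(\<lambda>z. s z - t z) holomorphic_on D" by (intro holomorphic_intros s t)
  then have "vanishes_to D p 0 (\<lambda>z. s z + Q z * 0 - t z)" by (auto simp: vanishes_to_def)
  then show ?case using 0 by (intro exI[of _ "\<lambda>_. 0"]) simp
next
  case (Suc m)
  obtain u k where u: "u holomorphic_on D" "\<And>z. z \<in> K \<Longrightarrow> norm (Q z * u z) \<le> \<epsilon> / 2"
    and k: "k holomorphic_on D" "\<And>z. z \<in> D \<Longrightarrow> s z + Q z * u z - t z = (z - p) ^ m * k z"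
    using Suc.IH[of "\<epsilon> / 2"] Suc.prems unfolding vanishes_to_def by auto
  \<comment> \<open>This coefficient cancels the value \<open>k p\<close> of the remaining error's
    cofactor; \<open>Q p\<close> is divided out because the correction is multiplied by
    \<open>Q\<close>.\<close>
  define c where "c = - k p / Q p"
  define g where "g = (\<lambda>z. c * Q z * (z - p) ^ m)"
  have g: "g holomorphic_on D" unfolding g_def by (intro holomorphic_intros Q)
  have "continuous_on K g"
    using g K(2) by (meson continuous_on_subset holomorphic_on_imp_continuous_on)
  then have "bounded (g ` K)" using K(1) by (simp add: compact_continuous_image compact_imp_bounded)
  then obtain B where B: "B > 0" "\<And>z. z \<in> K \<Longrightarrow> norm (g z) \<le> B"
    unfolding bounded_pos by auto
  obtain N where N: "(1 / 2) ^ N < \<epsilon> / 2 / B"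
    using real_arch_pow_inv[of "\<epsilon> / 2 / B" "1 / 2"] Suc.prems B(1) by auto
  define v where "v = (\<lambda>z. u z + \<phi> z ^ N * (c * (z - p) ^ m))"
  have v: "v holomorphic_on D" unfolding v_def by (intro holomorphic_intros u \<phi>)
  have "norm (Q z * v z) \<le> \<epsilon>" if z: "z \<in> K" for z
  proof -
    have "norm (\<phi> z ^ N * g z) \<le> (1 / 2) ^ N * B"
      unfolding norm_mult norm_power using K(3)[OF z] B(2)[OF z] B(1)
      by (intro mult_mono power_mono) auto
    also have "\<dots> \<le> \<epsilon> / 2" using N B(1) by (simp add: field_simps)
    finally have "norm (Q z * u z + \<phi> z ^ N * g z) \<le> \<epsilon> / 2 + \<epsilon> / 2"
      by (intro norm_triangle_mono u z)
    moreover have "Q z * v z = Q z * u z + \<phi> z ^ N * g z"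
      by (simp add: v_def g_def algebra_simps)
    ultimately show ?thesis by simp
  qed
  moreover have "vanishes_to D p (Suc m) (\<lambda>z. s z + Q z * v z - t z)"
  proof (rule vanishes_to_Suc[OF D])
    show "(\<lambda>z. k z + c * Q z * \<phi> z ^ N) holomorphic_on D"
      by (intro holomorphic_intros k Q \<phi>)
    show "k p + c * Q p * \<phi> p ^ N = 0" using Q(2) by (simp add: c_def \<phi>(2))
    show "s z + Q z * v z - t z = (z - p) ^ m * (k z + c * Q z * \<phi> z ^ N)" if "z \<in> D" for z
      using k(2)[OF that] by (simp add: v_def algebra_simps)
  qed
  ultimately show ?case using v by blast
qed

lemma vanishes_to_prod:
  assumes "finite A" "p \<in> A"
  shows "vanishes_to D p (m p) (\<lambda>z. \<Prod>x\<in>A. (z - x) ^ m x)"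
proof -
  have "(\<lambda>z. \<Prod>x\<in>A - {p}. (z - x) ^ m x) holomorphic_on D" by (intro holomorphic_intros)
  then show ?thesis
    unfolding vanishes_to_def using assms
    by (intro exI[of _ "\<lambda>z. \<Prod>x\<in>A - {p}. (z - x) ^ m x"]) (simp add: prod.remove)
qed

theorem holomorphic_jet_interpolation:
  assumes D: "open (D :: complex set)" and P: "locally_finite_subset D P"
    and t: "\<And>p. p \<in> P \<Longrightarrow> t p holomorphic_on D"
  obtains f where "f holomorphic_on D" "\<And>p. p \<in> P \<Longrightarrow> vanishes_to D p (m p) (\<lambda>z. f z - t p z)"
proof -
  obtain h :: "complex \<Rightarrow> real" where h: "continuous_on D h" "\<And>z. z \<in> D \<Longrightarrow> h z \<ge> 1"
    and hc: "\<And>R. compact {z\<in>D. h z \<le> R}"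
    and h\<phi>: "\<And>p. p \<in> D \<Longrightarrow> \<exists>\<phi>. \<phi> holomorphic_on D \<and> \<phi> p = 1 \<and> (\<forall>z\<in>D. norm (\<phi> z) \<le> h z / h p)"
    using exhaustion_function[OF D] by blast
  have PD: "P \<subseteq> D" using P by (auto simp: locally_finite_subset_def)
  have fin: "finite (P \<inter> {z\<in>D. h z \<le> R})" for R
    using locally_finite_subset_compact[OF P hc] by auto
  have cov: "P \<subseteq> (\<Union>n. P \<inter> {z\<in>D. h z \<le> real n})"
  proof
    fix p assume "p \<in> P"
    moreover obtain n where "h p \<le> real n" using real_arch_simple by blast
    ultimately show "p \<in> (\<Union>n. P \<inter> {z\<in>D. h z \<le> real n})" using PD by blast
  qed
  have "countable (\<Union>n. P \<inter> {z\<in>D. h z \<le> real n})"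
    by (rule countable_UN) (simp, rule countable_finite, rule fin)
  then have cnt: "countable P" using cov by (rule countable_subset[rotated])
  define i where "i = to_nat_on P"
  have inj: "inj_on i P" unfolding i_def using cnt by (rule inj_on_to_nat_on)
  define Inv where "Inv = (\<lambda>n s. s holomorphic_on D \<and>
    (\<forall>p\<in>P. i p < n \<longrightarrow> vanishes_to D p (m p) (\<lambda>z. s z - t p z)))"
  \<comment> \<open>There is at most one \<open>p\<close> with \<open>i p = n\<close>; the condition on \<open>h z\<close> is void if there is none.\<close>
  define Close where "Close = (\<lambda>n s s'. \<forall>z\<in>D. (\<forall>p\<in>P. i p = n \<longrightarrow> h z \<le> h p / 2) \<longrightarrow>
    norm (s' z - s z :: complex) \<le> (1 / 2) ^ n)"
  have "\<exists>s. \<forall>n. Inv n (s n) \<and> Close n (s n) (s (Suc n))"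
  proof (rule dependent_nat_choice)
    show "\<exists>s. Inv 0 s" unfolding Inv_def by (intro exI[of _ "\<lambda>_. 0"]) auto
  next
    fix s n assume s: "Inv n s"
    show "\<exists>s'. Inv (Suc n) s' \<and> Close n s s'"
    proof (cases "\<exists>p\<in>P. i p = n")
      case False
      then have "Inv (Suc n) s" using s unfolding Inv_def by (auto simp: less_Suc_eq)
      then show ?thesis by (intro exI[of _ s]) (auto simp: Close_def)
    next
      case True
      then obtain p where p: "p \<in> P" "i p = n" by auto
      have pD: "p \<in> D" using p PD by auto
      have hp: "h p \<ge> 1" using h(2) pD .
      define A where "A = {x\<in>P. i x < n}"
      have "finite (i ` A)" by (rule finite_subset[of _ "{..<n}"]) (auto simp: A_def)
      then have A: "finite A" "p \<notin> A"
        using inj p(2) by (auto simp: A_def dest!: finite_imageD intro: inj_on_subset)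
      \<comment> \<open>Multiples of \<open>Q\<close> vanish to order \<open>m x\<close> at each
        earlier point \<open>x\<close>, so the jets already reached there are kept.\<close>
      define Q where "Q = (\<lambda>z. \<Prod>x\<in>A. (z - x) ^ m x)"
      have Q: "Q holomorphic_on D" "Q p \<noteq> 0"
        unfolding Q_def using A by (auto intro!: holomorphic_intros simp: prod_zero_iff)
      obtain \<phi> where \<phi>: "\<phi> holomorphic_on D" "\<phi> p = 1" "\<And>z. z \<in> D \<Longrightarrow> norm (\<phi> z) \<le> h z / h p"
        using h\<phi>[OF pD] by blast
      have sh: "s holomorphic_on D" using s by (simp add: Inv_def)
      have half: "norm (\<phi> z) \<le> 1 / 2" if "z \<in> {z\<in>D. h z \<le> h p / 2}" for z
      proof -
        have "norm (\<phi> z) \<le> h z / h p" using \<phi>(3) that by auto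
        also have "\<dots> \<le> (h p / 2) / h p" using that hp by (intro divide_right_mono) auto
        finally show ?thesis using hp by simp
      qed
      obtain u where u: "u holomorphic_on D"
        "vanishes_to D p (m p) (\<lambda>z. s z + Q z * u z - t p z)"
        "\<And>z. z \<in> {z\<in>D. h z \<le> h p / 2} \<Longrightarrow> norm (Q z * u z) \<le> (1 / 2) ^ n"
        using correction_step[OF D pD sh t[OF p(1)] Q \<phi>(1,2) hc[of "h p / 2"] _ half,
            of "(1 / 2) ^ n" "m p"] by auto
      have "vanishes_to D x (m x) (\<lambda>z. s z + Q z * u z - t x z)" if x: "x \<in> P" "i x < Suc n" for x
      proof (cases "i x = n")
        case True
        then have "x = p" using inj x(1) p by (auto dest: inj_onD)
        then show ?thesis using u(2) by simp
      next
        case False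
        then have "x \<in> A" using x by (auto simp: A_def)
        then have "vanishes_to D x (m x) (\<lambda>z. u z * Q z)"
          unfolding Q_def by (intro vanishes_to_mult vanishes_to_prod A u)
        moreover have "vanishes_to D x (m x) (\<lambda>z. s z - t x z)"
          using s x False by (auto simp: Inv_def)
        ultimately have "vanishes_to D x (m x) (\<lambda>z. u z * Q z + (s z - t x z))"
          by (rule vanishes_to_add)
        then show ?thesis by (rule vanishes_to_cong) simp
      qed
      then have "Inv (Suc n) (\<lambda>z. s z + Q z * u z)"
        unfolding Inv_def using sh Q u(1) by (auto intro!: holomorphic_intros)
      moreover have "Close n s (\<lambda>z. s z + Q z * u z)"
        unfolding Close_def using u(3) p by auto
      ultimately show ?thesis by blast
    qed
  qed
  then obtain s where s0: "\<forall>n. Inv n (s n) \<and> Close n (s n) (s (Suc n))" ..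
  have s: "Inv n (s n)" "Close n (s n) (s (Suc n))" for n
    using s0[rule_format, of n] by auto
  define f where "f = (\<lambda>z. lim (\<lambda>n. s n z))"
  have unif: "uniform_limit {z\<in>D. h z \<le> R} s f sequentially" for R
  proof -
    \<comment> \<open>Only finitely many points have \<open>h p \<le> 2 * R\<close>. Beyond their
      indices every correction belongs to a point with \<open>h p > 2 * R\<close>, so the set
      \<open>h z \<le> R\<close> lies where that correction is at most
      \<open>(1 / 2) ^ n\<close>.\<close>
    have "finite (i ` (P \<inter> {z\<in>D. h z \<le> 2 * R}))" by (intro finite_imageI fin)
    then obtain n0 where "i ` (P \<inter> {z\<in>D. h z \<le> 2 * R}) \<subseteq> {..<n0}"
      using finite_nat_bounded by blast
    then have n0: "i p < n0" if "p \<in> P" "h p \<le> 2 * R" for p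
      using that PD by blast
    have bd: "norm (s (Suc n) z - s n z) \<le> (1 / 2) ^ n" if "n \<ge> n0" "z \<in> D" "h z \<le> R" for n z
    proof -
      have "h z \<le> h p / 2" if "p \<in> P" "i p = n" for p
        using n0[OF that(1)] that \<open>n \<ge> n0\<close> \<open>h z \<le> R\<close> by force
      then show ?thesis using s(2)[of n] that unfolding Close_def by blast
    qed
    have "uniformly_convergent_on {z\<in>D. h z \<le> R} (\<lambda>n z. \<Sum>k<n. s (Suc k) z - s k z)"
    proof (rule Weierstrass_m_test'_ev)
      show "\<forall>\<^sub>F n in sequentially. \<forall>z\<in>{z\<in>D. h z \<le> R}. norm (s (Suc n) z - s n z) \<le> (1 / 2) ^ n"
        using bd by (auto simp: eventually_sequentially)
      show "summable (\<lambda>n. (1 / 2 :: real) ^ n)" by simp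
    qed
    then obtain g where "uniform_limit {z\<in>D. h z \<le> R} (\<lambda>n z. \<Sum>k<n. s (Suc k) z - s k z) g sequentially"
      unfolding uniformly_convergent_on_def by blast
    then have "uniform_limit {z\<in>D. h z \<le> R} (\<lambda>n z. (\<Sum>k<n. s (Suc k) z - s k z) + s 0 z)
        (\<lambda>z. g z + s 0 z) sequentially"
      by (intro uniform_limit_add uniform_limit_const)
    then have *: "uniform_limit {z\<in>D. h z \<le> R} s (\<lambda>z. g z + s 0 z) sequentially"
      by (simp add: sum_lessThan_telescope[of "\<lambda>k. s k z" for z])
    have "f z = g z + s 0 z" if "z \<in> {z\<in>D. h z \<le> R}" for z
      unfolding f_def using tendsto_uniform_limitI[OF * that] by (rule limI)
    then show ?thesis
      using * by (subst uniform_limit_cong') auto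
  qed
  have loc: "\<exists>d>0. cball z d \<subseteq> D \<and> uniform_limit (cball z d) s f sequentially" if z: "z \<in> D" for z
  proof -
    obtain d where d: "d > 0" "cball z d \<subseteq> D" using D z open_contains_cball by blast
    have "bounded (h ` cball z d)"
      using h(1) d(2) by (intro compact_imp_bounded compact_continuous_image)
        (auto intro: continuous_on_subset)
    then obtain R where "\<forall>x\<in>h ` cball z d. norm x \<le> R" unfolding bounded_iff ..
    then have "cball z d \<subseteq> {z\<in>D. h z \<le> R}" using d(2) by force
    then show ?thesis using d uniform_limit_on_subset[OF unif] by blast
  qed
  have sh: "s n holomorphic_on D" for n using s(1) by (simp add: Inv_def)
  have fh: "f holomorphic_on D"
    by (rule holomorphic_uniform_sequence[OF D sh loc])
  have "vanishes_to D p (m p) (\<lambda>z. f z - t p z)" if p: "p \<in> P" for p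
  proof (subst vanishes_to_iff_higher_deriv[OF D])
    have pD: "p \<in> D" using p PD by auto
    then show "p \<in> D" .
    show "(\<lambda>z. f z - t p z) holomorphic_on D" by (intro holomorphic_intros fh t p)
    show "\<forall>n<m p. (deriv ^^ n) (\<lambda>z. f z - t p z) p = 0"
    proof (intro allI impI)
      fix n assume n: "n < m p"
      obtain d where d: "d > 0" "cball p d \<subseteq> D" "uniform_limit (cball p d) s f sequentially"
        using loc[OF pD] by blast
      have "(\<lambda>j. (deriv ^^ n) (s j) p) \<longlonglongrightarrow> (deriv ^^ n) f p"
      proof (rule higher_deriv_complex_uniform_limit)
        show "uniform_limit (ball p d) s f sequentially"
          using d(3) by (rule uniform_limit_on_subset) auto
        show "\<forall>\<^sub>F j in sequentially. s j holomorphic_on ball p d"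
          using d(2) ball_subset_cball by (intro always_eventually allI holomorphic_on_subset[OF sh]) blast
      qed (use d in auto)
      \<comment> \<open>From index \<open>i p + 1\<close> on, all approximants have the prescribed
        jet at \<open>p\<close>, so the convergent sequence of derivatives is eventually
        constant.\<close>
      moreover have "\<forall>\<^sub>F j in sequentially. (deriv ^^ n) (s j) p = (deriv ^^ n) (t p) p"
      proof -
        have "(deriv ^^ n) (s j) p = (deriv ^^ n) (t p) p" if "j > i p" for j
        proof -
          have "vanishes_to D p (m p) (\<lambda>z. s j z - t p z)" using s(1)[of j] p that by (auto simp: Inv_def)
          then have "(deriv ^^ n) (\<lambda>z. s j z - t p z) p = 0"
            using n by (subst (asm) vanishes_to_iff_higher_deriv[OF D pD])
              (auto intro!: holomorphic_intros sh t p)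
          then show ?thesis
            using higher_deriv_diff[OF sh[of j] t[OF p] D pD] by simp
        qed
        then show ?thesis by (intro eventually_mono[OF eventually_gt_at_top[of "i p"]])
      qed
      ultimately have "(deriv ^^ n) f p = (deriv ^^ n) (t p) p"
        by (rule LIMSEQ_unique[OF _ tendsto_eventually])
      then show "(deriv ^^ n) (\<lambda>z. f z - t p z) p = 0"
        using higher_deriv_diff[OF fh t[OF p] D pD] by simp
    qed
  qed
  then show ?thesis using that fh by blast
qed

section \<open>Interpolation compatible with complex conjugation\<close>

lemma holomorphic_on_cnj_cnj:
  assumes "open D" "\<And>z. z \<in> D \<Longrightarrow> cnj z \<in> D" "f holomorphic_on D"
  shows "(\<lambda>z. cnj (f (cnj z))) holomorphic_on D"
proof -
  have "cnj ` D \<subseteq> D" using assms(2) by auto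
  then have "cnj \<circ> f \<circ> cnj holomorphic_on D"
    using assms by (intro holomorphic_on_compose_cnj_cnj) (auto intro: holomorphic_on_subset)
  then show ?thesis by (simp add: o_def)
qed

lemma vanishes_to_cnj_cnj:
  assumes "open D" "\<And>z. z \<in> D \<Longrightarrow> cnj z \<in> D" "vanishes_to D (cnj p) m f"
  shows "vanishes_to D p m (\<lambda>z. cnj (f (cnj z)))"
proof -
  obtain k where k: "k holomorphic_on D" "\<And>z. z \<in> D \<Longrightarrow> f z = (z - cnj p) ^ m * k z"
    using assms(3) unfolding vanishes_to_def by blast
  show ?thesis unfolding vanishes_to_def
    by (intro exI[of _ "\<lambda>z. cnj (k (cnj z))"] conjI holomorphic_on_cnj_cnj assms k)
       (use k assms in auto)
qed

text \<open>The mirrored target is prescribed at the mirrored point. Then \<open>f\<close> and its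
  conjugate reflection both have the jet of \<open>t p\<close> at \<open>p\<close>, and so does
  their mean.\<close>

theorem symmetric_jet_interpolation:
  assumes D: "open D" and sym: "\<And>z. z \<in> D \<Longrightarrow> cnj z \<in> D"
    and P: "locally_finite_subset D P" and Im: "\<And>p. p \<in> P \<Longrightarrow> Im p \<ge> 0"
    and t: "\<And>p. p \<in> P \<Longrightarrow> t p holomorphic_on D"
    and real: "\<And>p z. p \<in> P \<Longrightarrow> Im p = 0 \<Longrightarrow> t p (cnj z) = cnj (t p z)"
  obtains f where "f holomorphic_on D" "\<And>z. z \<in> D \<Longrightarrow> f (cnj z) = cnj (f z)"
    "\<And>p. p \<in> P \<Longrightarrow> vanishes_to D p (m p) (\<lambda>z. f z - t p z)"
proof -
  define P' where "P' = P \<union> cnj ` P"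
  define m' where "m' = (\<lambda>p. if p \<in> P then m p else m (cnj p))"
  define t' where "t' = (\<lambda>p z. if p \<in> P then t p z else cnj (t (cnj p) (cnj z)))"
  have PD: "P \<subseteq> D" using P by (auto simp: locally_finite_subset_def)
  have "locally_finite_subset D P'"
    unfolding locally_finite_subset_def
  proof (intro conjI ballI)
    show "P' \<subseteq> D" using PD sym by (auto simp: P'_def)
    fix z assume z: "z \<in> D"
    obtain d e where d: "d > 0" "finite (P \<inter> ball z d)" and e: "e > 0" "finite (P \<inter> ball (cnj z) e)"
      using P z sym[OF z] unfolding locally_finite_subset_def by blast
    have "P' \<inter> ball z (min d e) \<subseteq> (P \<inter> ball z d) \<union> cnj ` (P \<inter> ball (cnj z) e)"
    proof
      fix x assume x: "x \<in> P' \<inter> ball z (min d e)"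
      have "dist (cnj z) (cnj x) = dist z x"
        by (metis complex_cnj_diff complex_mod_cnj dist_norm)
      then show "x \<in> (P \<inter> ball z d) \<union> cnj ` (P \<inter> ball (cnj z) e)"
        using x by (auto simp: P'_def image_iff)
    qed
    then have "finite (P' \<inter> ball z (min d e))" by (rule finite_subset) (use d e in simp)
    then show "\<exists>e>0. finite (P' \<inter> ball z e)" using d(1) e(1) by (intro exI[of _ "min d e"]) simp
  qed
  moreover have "t' p holomorphic_on D" if "p \<in> P'" for p
  proof (cases "p \<in> P")
    case True
    then show ?thesis using t by (simp add: t'_def)
  next
    case False
    then have "cnj p \<in> P" using that by (auto simp: P'_def)
    then show ?thesis using False holomorphic_on_cnj_cnj[OF D sym t] by (simp add: t'_def)
  qed
  ultimately obtain f where f: "f holomorphic_on D"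
    "\<And>p. p \<in> P' \<Longrightarrow> vanishes_to D p (m' p) (\<lambda>z. f z - t' p z)"
    using holomorphic_jet_interpolation[OF D, of P' t' m'] by blast
  define g where "g = (\<lambda>z. (f z + cnj (f (cnj z))) / 2)"
  have "g holomorphic_on D"
    unfolding g_def by (intro holomorphic_intros f holomorphic_on_cnj_cnj D sym) auto
  moreover have "g (cnj z) = cnj (g z)" for z by (simp add: g_def add.commute)
  moreover have "vanishes_to D p (m p) (\<lambda>z. g z - t p z)" if p: "p \<in> P" for p
  proof -
    have 1: "vanishes_to D p (m p) (\<lambda>z. f z - t p z)"
      using f(2)[of p] p by (simp add: P'_def m'_def t'_def)
    \<comment> \<open>If \<open>cnj p\<close> is in \<open>P\<close> too, both imaginary parts are
      nonnegative, so \<open>p\<close> is real, and there the target is its own mirror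
      image.\<close>
    have eq: "m' (cnj p) = m p" "cnj (t' (cnj p) (cnj z)) = t p z" for z
    proof -
      have *: "cnj p = p" "Im p = 0" if "cnj p \<in> P"
        using Im[OF that] Im[OF p] by (auto simp: complex_eq_iff)
      show "m' (cnj p) = m p" using * by (auto simp: m'_def)
      show "cnj (t' (cnj p) (cnj z)) = t p z" using * real[OF p] by (auto simp: t'_def)
    qed
    have "vanishes_to D (cnj p) (m p) (\<lambda>z. f z - t' (cnj p) z)"
      using f(2)[of "cnj p"] p eq(1) by (simp add: P'_def)
    from vanishes_to_cnj_cnj[OF D sym this]
    have 2: "vanishes_to D p (m p) (\<lambda>z. cnj (f (cnj z)) - t p z)" by (simp add: eq(2))
    have "vanishes_to D p (m p) (\<lambda>z. (1 / 2) * ((f z - t p z) + (cnj (f (cnj z)) - t p z)))"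
      by (intro vanishes_to_mult vanishes_to_add 1 2) auto
    then show ?thesis by (rule vanishes_to_cong) (simp add: g_def field_simps)
  qed
  ultimately show ?thesis using that by blast
qed

subsection \<open>Quaternions and slice functions\<close>

lemma qreal_nth [simp]: "qreal r $ 1 = r" "qreal r $ 2 = 0" "qreal r $ 3 = 0" "qreal r $ 4 = 0"
  by (simp_all add: qreal_def vector_def)

lemma qreal_axis: "qreal r = r *\<^sub>R axis 1 1"
  by (simp add: vec_eq_iff forall_4 axis_def)

lemma qi_nth [simp]: "qi $ 1 = 0" "qi $ 2 = 1" "qi $ 3 = 0" "qi $ 4 = 0"
  by (simp_all add: qi_def vector_def)

lemma qmul_nth:
  "(p \<star> q) $ 1 = p $ 1 * q $ 1 - p $ 2 * q $ 2 - p $ 3 * q $ 3 - p $ 4 * q $ 4"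
  "(p \<star> q) $ 2 = p $ 1 * q $ 2 + p $ 2 * q $ 1 + p $ 3 * q $ 4 - p $ 4 * q $ 3"
  "(p \<star> q) $ 3 = p $ 1 * q $ 3 - p $ 2 * q $ 4 + p $ 3 * q $ 1 + p $ 4 * q $ 2"
  "(p \<star> q) $ 4 = p $ 1 * q $ 4 + p $ 2 * q $ 3 - p $ 3 * q $ 2 + p $ 4 * q $ 1"
  by (simp_all add: qmul_def)

lemma qmul_assoc: "p \<star> q \<star> r = p \<star> (q \<star> r)"
  by (simp add: vec_eq_iff forall_4 qmul_nth algebra_simps)

lemma qmul_distrib:
  "p \<star> (q + r) = p \<star> q + p \<star> r" "p \<star> (q - r) = p \<star> q - p \<star> r"
  "(q + r) \<star> p = q \<star> p + r \<star> p" "(q - r) \<star> p = q \<star> p - r \<star> p"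
  by (simp_all add: vec_eq_iff forall_4 qmul_nth algebra_simps)

lemma norm_quat: "norm (q :: quat) = sqrt ((q $ 1)\<^sup>2 + (q $ 2)\<^sup>2 + (q $ 3)\<^sup>2 + (q $ 4)\<^sup>2)"
  by (simp add: norm_vec_def L2_set_def sum_4)

text \<open>The imaginary part of the square of \<open>J\<close> is twice \<open>J $ 1\<close> times
  the imaginary part of \<open>J\<close>. A nonzero real part would therefore make \<open>J\<close>
  real, with a nonnegative square.\<close>

lemma sphS_iff: "J \<in> sphS \<longleftrightarrow> J $ 1 = 0 \<and> norm J = 1"
proof
  assume "J \<in> sphS"
  then have e: "J $ 1 * J $ 1 - J $ 2 * J $ 2 - J $ 3 * J $ 3 - J $ 4 * J $ 4 = - 1"
    "J $ 1 * J $ 2 = 0" "J $ 1 * J $ 3 = 0" "J $ 1 * J $ 4 = 0"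
    by (simp_all add: sphS_def vec_eq_iff forall_4 qmul_nth)
  have "J $ 1 = 0"
  proof (rule ccontr)
    assume "J $ 1 \<noteq> 0"
    then have "J $ 1 * J $ 1 = - 1" using e by simp
    then show False by (metis not_square_less_zero less_minus_one_simps(1))
  qed
  then show "J $ 1 = 0 \<and> norm J = 1" using e(1) by (simp add: norm_quat power2_eq_square)
next
  assume "J $ 1 = 0 \<and> norm J = 1"
  then have "J $ 1 = 0" "(J $ 2)\<^sup>2 + (J $ 3)\<^sup>2 + (J $ 4)\<^sup>2 = 1" by (auto simp: norm_quat)
  then show "J \<in> sphS"
    by (simp add: sphS_def vec_eq_iff forall_4 qmul_nth power2_eq_square algebra_simps)
qed

lemma qi_in_sphS [simp]: "qi \<in> sphS"
  by (simp add: sphS_iff norm_quat)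

lemma qim_nth [simp]: "qim q $ 1 = 0" "qim q $ 2 = q $ 2" "qim q $ 3 = q $ 3" "qim q $ 4 = q $ 4"
  by (simp_all add: qim_def)

section \<open>The closed upper half plane as the space of spheres and real points\<close>

definition slice_coord :: "quat \<Rightarrow> complex" where
  "slice_coord q = Complex (qre q) (norm (qim q))"

lemma slice_decomposition:
  obtains J where "J \<in> sphS" "q = qreal (Re (slice_coord q)) + Im (slice_coord q) *\<^sub>R J"
proof (cases "qim q = 0")
  case True
  then have "q = qreal (qre q)" by (simp add: qim_def qre_def)
  then show ?thesis using True that[of qi] by (simp add: slice_coord_def)
next
  case False
  have "(1 / norm (qim q)) *\<^sub>R qim q \<in> sphS" using False by (simp add: sphS_iff)
  then show ?thesis
    by (rule that) (use False in \<open>simp add: slice_coord_def qim_def qre_def\<close>)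
qed

lemma qre_qim_slice:
  assumes "J \<in> sphS"
  shows "qre (qreal x + y *\<^sub>R J) = x" "qim (qreal x + y *\<^sub>R J) = y *\<^sub>R J"
  using assms by (simp_all add: sphS_iff qre_def vec_eq_iff forall_4)

lemma slice_coord_slice:
  assumes "J \<in> sphS" shows "slice_coord (qreal x + y *\<^sub>R J) = Complex x \<bar>y\<bar>"
  using assms by (simp add: slice_coord_def qre_qim_slice) (simp add: sphS_iff)

lemma qcx_eq: "qcx (Complex x y) = qreal x + y *\<^sub>R qi"
  by (simp add: qcx_def)

lemma axially_symmetricD:
  assumes "axially_symmetric \<Omega>" "J \<in> sphS"
  shows "qreal x + y *\<^sub>R J \<in> \<Omega> \<longleftrightarrow> qcx (Complex x y) \<in> \<Omega>"
  using assms qi_in_sphS unfolding axially_symmetric_def qcx_eq by blast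

lemma minus_in_sphS: "J \<in> sphS \<Longrightarrow> - J \<in> sphS"
  by (simp add: sphS_iff)

lemma qcx_cnj_iff:
  assumes "axially_symmetric \<Omega>" shows "qcx (cnj z) \<in> \<Omega> \<longleftrightarrow> qcx z \<in> \<Omega>"
proof -
  have "qcx (cnj z) = qreal (Re z) + Im z *\<^sub>R (- qi)" by (simp add: qcx_def)
  then show ?thesis
    using axially_symmetricD[OF assms minus_in_sphS[OF qi_in_sphS], of "Re z" "Im z"] by simp
qed

lemma qcx_slice_coord_iff:
  assumes "axially_symmetric \<Omega>" shows "qcx (slice_coord q) \<in> \<Omega> \<longleftrightarrow> q \<in> \<Omega>"
proof -
  obtain J where J: "J \<in> sphS" "q = qreal (Re (slice_coord q)) + Im (slice_coord q) *\<^sub>R J"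
    using slice_decomposition .
  show ?thesis
    using axially_symmetricD[OF assms J(1), of "Re (slice_coord q)" "Im (slice_coord q)"] J(2) by simp
qed

lemma continuous_qcx: "continuous_on UNIV qcx"
  unfolding qcx_def qreal_axis by (intro continuous_intros)

lemma open_stem_domain:
  assumes "open \<Omega>" shows "open {z. qcx z \<in> \<Omega>}"
  using open_vimage[OF assms continuous_qcx] by (simp add: vimage_def)

lemma continuous_slice_coord: "continuous_on UNIV slice_coord"
  unfolding slice_coord_def Complex_eq qre_def qim_def qreal_axis
  by (intro continuous_intros)

text \<open>An \<open>\<H>\<otimes>\<C>\<close>-valued stem function is represented by its four complex components \<open>w m\<close>;
  \<open>slice_value J\<close> is evaluation \<open>F\<^sub>1 + J F\<^sub>2\<close>.\<close>

definition slice_value :: "quat \<Rightarrow> (4 \<Rightarrow> complex) \<Rightarrow> quat" where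
  "slice_value J w = (\<chi> m. Re (w m)) + J \<star> (\<chi> m. Im (w m))"

text \<open>\<open>y\<close> may have either sign, so the condition covers both ways (y, J) and (-y,
  -J) of writing a nonreal point. Holomorphy and symmetry are left out, so that the notion can be
  iterated under slice derivatives.\<close>

definition slice_rep :: "quat set \<Rightarrow> (quat \<Rightarrow> quat) \<Rightarrow> (4 \<Rightarrow> complex \<Rightarrow> complex) \<Rightarrow> bool" where
  "slice_rep \<Omega> f G \<longleftrightarrow> (\<forall>x y J. J \<in> sphS \<longrightarrow> qreal x + y *\<^sub>R J \<in> \<Omega> \<longrightarrow>
     f (qreal x + y *\<^sub>R J) = slice_value J (\<lambda>m. G m (Complex x y)))"

text \<open>A finite real-linear combination with constant vectors: in this form series and
  derivatives pass through the evaluation.\<close>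

lemma slice_value_sum:
  "slice_value J w = (\<Sum>m\<in>UNIV. Re (w m) *\<^sub>R axis m 1 + Im (w m) *\<^sub>R (J \<star> axis m 1))"
  by (simp add: slice_value_def sum_4 vec_eq_iff forall_4 qmul_nth axis_def algebra_simps)

lemma sums_slice_value:
  assumes "\<And>m. (\<lambda>n. w n m) sums W m"
  shows "(\<lambda>n. slice_value J (w n)) sums slice_value J W"
  unfolding slice_value_sum
  using assms by (intro sums_sum sums_add sums_scaleR_left sums_Re sums_Im)

lemma has_vector_derivative_slice_value:
  assumes "\<And>m. ((\<lambda>t. w t m) has_vector_derivative w' m) (at t)"
  shows "((\<lambda>t. slice_value J (w t)) has_vector_derivative slice_value J w') (at t)"
proof -
  have "((\<lambda>t. Re (w t m)) has_vector_derivative Re (w' m)) (at t)"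
    "((\<lambda>t. Im (w t m)) has_vector_derivative Im (w' m)) (at t)" for m
    using bounded_linear.has_vector_derivative[OF bounded_linear_Re assms]
      bounded_linear.has_vector_derivative[OF bounded_linear_Im assms] by blast+
  then show ?thesis
    unfolding slice_value_sum
    by (intro has_vector_derivative_sum has_vector_derivative_add
        bounded_linear.has_vector_derivative[OF bounded_linear_scaleR_left])
qed

text \<open>Adding a real number to a quaternion keeps \<open>J\<close> and \<open>y\<close> and
  moves the stem variable horizontally, where the derivative of a holomorphic component is its
  complex derivative.\<close>

lemma slice_rep_sderiv:
  assumes \<Omega>: "open \<Omega>" "axially_symmetric \<Omega>" and G: "\<And>m. G m holomorphic_on {z. qcx z \<in> \<Omega>}"
    and f: "slice_rep \<Omega> f G"
  shows "slice_rep \<Omega> (sderiv f) (\<lambda>m. deriv (G m))"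
  unfolding slice_rep_def
proof (intro allI impI)
  fix x y J assume J: "J \<in> sphS" "qreal x + y *\<^sub>R J \<in> \<Omega>"
  have add: "qreal x + y *\<^sub>R J + qreal t = qreal (x + t) + y *\<^sub>R J" for t
    by (simp add: vec_eq_iff forall_4)
  have D: "Complex x y \<in> {z. qcx z \<in> \<Omega>}" using J axially_symmetricD[OF \<Omega>(2)] by simp
  have "((\<lambda>t. G m (Complex (x + t) y)) has_vector_derivative deriv (G m) (Complex x y)) (at 0)" for m
  proof -
    have 1: "((\<lambda>t. Complex (x + t) y) has_vector_derivative 1) (at 0)"
      unfolding Complex_eq by (auto intro!: derivative_eq_intros simp: has_vector_derivative_def scaleR_conv_of_real)
    have 2: "(G m has_field_derivative deriv (G m) (Complex x y)) (at (Complex (x + 0) y))"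
      using holomorphic_derivI[OF G open_stem_domain[OF \<Omega>(1)] D] by simp
    show ?thesis using field_vector_diff_chain_at[OF 1 2] by (simp add: o_def)
  qed
  then have "((\<lambda>t. slice_value J (\<lambda>m. G m (Complex (x + t) y))) has_vector_derivative
      slice_value J (\<lambda>m. deriv (G m) (Complex x y))) (at 0)"
    by (rule has_vector_derivative_slice_value)
  moreover have "open {t. qreal x + y *\<^sub>R J + qreal t \<in> \<Omega>}"
  proof -
    have "continuous_on UNIV (\<lambda>t. qreal x + y *\<^sub>R J + t *\<^sub>R qreal 1)" by (intro continuous_intros)
    from open_vimage[OF \<Omega>(1) this] have "open {t. qreal x + y *\<^sub>R J + t *\<^sub>R qreal 1 \<in> \<Omega>}"
      by (simp add: vimage_def)
    moreover have "t *\<^sub>R qreal 1 = qreal t" for t by (simp add: vec_eq_iff forall_4)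
    ultimately show ?thesis by simp
  qed
  ultimately have "((\<lambda>t. f (qreal x + y *\<^sub>R J + qreal t)) has_vector_derivative
      slice_value J (\<lambda>m. deriv (G m) (Complex x y))) (at 0)"
  proof (rule has_vector_derivative_transform_within_open)
    show "0 \<in> {t. qreal x + y *\<^sub>R J + qreal t \<in> \<Omega>}" using J(2) by (simp add: add)
    show "slice_value J (\<lambda>m. G m (Complex (x + t) y)) = f (qreal x + y *\<^sub>R J + qreal t)"
      if "t \<in> {t. qreal x + y *\<^sub>R J + qreal t \<in> \<Omega>}" for t
      using f J(1) that unfolding slice_rep_def by (simp add: add)
  qed
  then show "sderiv f (qreal x + y *\<^sub>R J) = slice_value J (\<lambda>m. deriv (G m) (Complex x y))"
    unfolding sderiv_def by (rule vector_derivative_at)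
qed

lemma slice_rep_higher_sderiv:
  assumes \<Omega>: "open \<Omega>" "axially_symmetric \<Omega>" and G: "\<And>m. G m holomorphic_on {z. qcx z \<in> \<Omega>}"
    and f: "slice_rep \<Omega> f G"
  shows "slice_rep \<Omega> ((sderiv ^^ n) f) (\<lambda>m. (deriv ^^ n) (G m))"
proof (induction n)
  case 0
  then show ?case using f by simp
next
  case (Suc n)
  then show ?case
    using slice_rep_sderiv[OF \<Omega> holomorphic_higher_deriv[OF G open_stem_domain[OF \<Omega>(1)]]] by simp
qed

lemma slice_regular_of_components:
  assumes G: "\<And>m. G m holomorphic_on {z. qcx z \<in> \<Omega>}"
    and sym: "\<And>m z. qcx z \<in> \<Omega> \<Longrightarrow> G m (cnj z) = cnj (G m z)"
    and f: "slice_rep \<Omega> f G"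
  shows "slice_regular \<Omega> f"
  unfolding slice_regular_def
proof (rule exI[of _ "\<lambda>z. \<chi> m. Re (G m z)"], rule exI[of _ "\<lambda>z. \<chi> m. Im (G m z)"],
    intro conjI allI impI)
  show "(\<lambda>z. Complex ((\<chi> m. Re (G m z)) $ m) ((\<chi> m. Im (G m z)) $ m)) holomorphic_on {z. qcx z \<in> \<Omega>}" for m
    using G by simp
qed (use sym f in \<open>simp_all add: vec_eq_iff slice_rep_def slice_value_def\<close>)

text \<open>A nonreal quaternion determines (y, J) up to a common sign, and a real one leaves
  \<open>J\<close> arbitrary. The symmetry of \<open>G\<close> is what makes the value independent
  of the choice.\<close>

lemma slice_rep_exists:
  assumes \<Omega>: "axially_symmetric \<Omega>"
    and sym: "\<And>m z. qcx z \<in> \<Omega> \<Longrightarrow> G m (cnj z) = cnj (G m z)"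
  obtains f where "slice_rep \<Omega> f G"
proof -
  define f where "f = (\<lambda>q. slice_value (SOME J. J \<in> sphS \<and>
    q = qreal (Re (slice_coord q)) + Im (slice_coord q) *\<^sub>R J) (\<lambda>m. G m (slice_coord q)))"
  have "slice_rep \<Omega> f G" unfolding slice_rep_def
  proof (intro allI impI)
    fix x y I assume I: "I \<in> sphS" "qreal x + y *\<^sub>R I \<in> \<Omega>"
    let ?q = "qreal x + y *\<^sub>R I"
    let ?z = "Complex x \<bar>y\<bar>"
    have zc: "slice_coord ?q = ?z" by (rule slice_coord_slice[OF I(1)])
    define J where "J = (SOME J. J \<in> sphS \<and> ?q = qreal x + \<bar>y\<bar> *\<^sub>R J)"
    obtain J' where "J' \<in> sphS" "?q = qreal (Re (slice_coord ?q)) + Im (slice_coord ?q) *\<^sub>R J'"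
      using slice_decomposition .
    then have "\<exists>J. J \<in> sphS \<and> ?q = qreal x + \<bar>y\<bar> *\<^sub>R J" using zc by auto
    from someI_ex[OF this] have J: "J \<in> sphS" "?q = qreal x + \<bar>y\<bar> *\<^sub>R J"
      unfolding J_def by blast+
    have fq: "f ?q = slice_value J (\<lambda>m. G m ?z)" by (simp add: f_def zc J_def)
    have yJ: "y *\<^sub>R I = \<bar>y\<bar> *\<^sub>R J" using J(2) by simp
    have zD: "qcx (Complex x y) \<in> \<Omega>" using I axially_symmetricD[OF \<Omega>] by simp
    \<comment> \<open>At a real point the components are real and \<open>J\<close> has no effect;
      for negative \<open>y\<close> the signs of \<open>J\<close> and of the imaginary parts change
      together.\<close>
    consider "y = 0" | "y > 0" "I = J" | "y < 0" "J = - I"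
    proof (cases "y \<ge> 0")
      case True
      then show ?thesis using yJ that by (cases "y = 0") auto
    next
      case False
      then have "y *\<^sub>R I = y *\<^sub>R (- J)" using yJ by simp
      then have "I = - J" using False by (simp only: scaleR_cancel_left) auto
      then show ?thesis using False that by auto
    qed
    then show "f ?q = slice_value I (\<lambda>m. G m (Complex x y))"
    proof cases
      case 1
      have "Im (G m (Complex x y)) = 0" for m
      proof -
        have "cnj (Complex x y) = Complex x y" using 1 by (simp add: complex_eq_iff)
        then have "G m (Complex x y) = cnj (G m (Complex x y))" using sym[OF zD, of m] by simp
        then show ?thesis by (simp add: complex_eq_iff)
      qed
      then show ?thesis unfolding fq using 1 by (simp add: slice_value_sum)
    next
      case 2
      then show ?thesis unfolding fq by simp
    next
      case 3
      have "Complex x \<bar>y\<bar> = cnj (Complex x y)" using 3 by (simp add: complex_eq_iff)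
      then have "G m ?z = cnj (G m (Complex x y))" for m using sym[OF zD] by simp
      then show ?thesis
        unfolding fq 3 by (simp add: slice_value_def vec_eq_iff forall_4 qmul_nth)
    qed
  qed
  then show ?thesis by (rule that)
qed

subsection \<open>Jets at points\<close>

lemma slice_coord_in_stem_domain:
  assumes "axially_symmetric \<Omega>" "q \<in> \<Omega>" shows "slice_coord q \<in> {z. qcx z \<in> \<Omega>}"
  using assms by (simp add: qcx_slice_coord_iff)

lemma higher_deriv_sum:
  assumes "open D" "p \<in> D" "finite I" "\<And>i. i \<in> I \<Longrightarrow> f i holomorphic_on D"
  shows "(deriv ^^ n) (\<lambda>z. \<Sum>i\<in>I. f i z) p = (\<Sum>i\<in>I. (deriv ^^ n) (f i) p)"
  using assms(3,4)
proof (induction I rule: finite_induct)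
  case (insert i I)
  have "(deriv ^^ n) (\<lambda>z. f i z + (\<Sum>i\<in>I. f i z)) p =
      (deriv ^^ n) (f i) p + (deriv ^^ n) (\<lambda>z. \<Sum>i\<in>I. f i z) p"
    by (rule higher_deriv_add[OF _ _ assms(1,2)]) (auto intro!: holomorphic_intros insert.prems)
  then show ?case using insert by simp
qed simp

text \<open>The target polynomials give the components the real derivatives
  \<open>fact n * A n $ m\<close>, so evaluation returns the prescribed quaternion whatever
  \<open>J\<close> is.\<close>

lemma has_jet_of_components:
  fixes A :: "nat \<Rightarrow> quat"
  assumes \<Omega>: "open \<Omega>" "axially_symmetric \<Omega>" and G: "\<And>m. G m holomorphic_on {z. qcx z \<in> \<Omega>}"
    and f: "slice_rep \<Omega> f G" and q: "q \<in> \<Omega>"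
    and van: "\<And>m. vanishes_to {z. qcx z \<in> \<Omega>} (slice_coord q) (Suc l)
      (\<lambda>z. G m z - (\<Sum>n\<le>l. of_real (A n $ m) * (z - slice_coord q) ^ n))"
  shows "has_jet f q l A"
  unfolding has_jet_def
proof (intro allI impI)
  fix n assume n: "n \<le> l"
  let ?D = "{z. qcx z \<in> \<Omega>}" and ?p = "slice_coord q"
  have D: "open ?D" by (rule open_stem_domain[OF \<Omega>(1)])
  have p: "?p \<in> ?D" by (rule slice_coord_in_stem_domain[OF \<Omega>(2) q])
  obtain J where J: "J \<in> sphS" "q = qreal (Re ?p) + Im ?p *\<^sub>R J" using slice_decomposition .
  have "(deriv ^^ n) (G m) ?p = of_real (fact n * A n $ m)" for m
  proof -
    let ?t = "\<lambda>z. \<Sum>i\<le>l. of_real (A i $ m) * (z - ?p) ^ i"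
    have th: "?t holomorphic_on ?D" by (intro holomorphic_intros)
    have "(deriv ^^ n) (\<lambda>z. G m z - ?t z) ?p = 0"
      using van[of m] n
      by (subst (asm) vanishes_to_iff_higher_deriv[OF D p]) (auto intro!: holomorphic_intros G)
    then have "(deriv ^^ n) (G m) ?p = (deriv ^^ n) ?t ?p"
      using higher_deriv_diff[OF G th D p] by simp
    also have "\<dots> = (\<Sum>i\<le>l. (deriv ^^ n) (\<lambda>z. of_real (A i $ m) * (z - ?p) ^ i) ?p)"
      by (rule higher_deriv_sum[OF D p]) (auto intro!: holomorphic_intros)
    also have "\<dots> = (\<Sum>i\<le>l. if i = n then of_real (fact n * A n $ m) else 0)"
    proof (rule sum.cong)
      fix i
      have "(deriv ^^ n) (\<lambda>z. of_real (A i $ m) * (z - ?p) ^ i) ?p =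
          of_real (A i $ m) * (deriv ^^ n) (\<lambda>z. (z - ?p) ^ i) ?p"
        by (rule higher_deriv_cmult[of _ UNIV]) (auto intro!: holomorphic_intros)
      \<comment> \<open>For \<open>i < n\<close> the rising factorial starts at 0, for
        \<open>i > n\<close> a power of 0 remains, and for \<open>i = n\<close> it is a
        factorial.\<close>
      also have "\<dots> = (if i = n then of_real (fact n * A n $ m) else 0)"
        unfolding higher_deriv_power by (cases i n rule: linorder_cases) (auto simp: pochhammer_0_left pochhammer_fact[symmetric])
      finally show "(deriv ^^ n) (\<lambda>z. of_real (A i $ m) * (z - ?p) ^ i) ?p =
          (if i = n then of_real (fact n * A n $ m) else 0)" .
    qed simp
    also have "\<dots> = of_real (fact n * A n $ m)" using n by simp
    finally show ?thesis .
  qed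
  moreover have "(sderiv ^^ n) f q = slice_value J (\<lambda>m. (deriv ^^ n) (G m) ?p)"
    using slice_rep_higher_sderiv[OF \<Omega> G f, of n] J q unfolding slice_rep_def by (metis complex.collapse)
  ultimately show "A n = (1 / fact n) *\<^sub>R (sderiv ^^ n) f q"
    by (simp add: slice_value_def vec_eq_iff forall_4 qmul_nth)
qed

subsection \<open>Spherical expansions\<close>

text \<open>The polynomial of the spherical expansion read in a slice plane; its zeros are a + i r
  and a - i r.\<close>

definition sphere_poly :: "real \<Rightarrow> real \<Rightarrow> complex \<Rightarrow> complex" where
  "sphere_poly a r z = (z - of_real a)\<^sup>2 + (of_real r)\<^sup>2"

lemma sphere_expansion:
  fixes a r :: real and K :: "complex \<Rightarrow> complex"
  assumes D: "open D" "Complex a r \<in> D" "Complex a (- r) \<in> D" and r: "r > 0"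
    and K: "K holomorphic_on D"
  obtains \<rho> and e d :: "nat \<Rightarrow> complex" where "\<rho> > 0" "\<And>z. cmod (sphere_poly a r z) < \<rho> \<Longrightarrow> z \<in> D"
    "\<And>z. cmod (sphere_poly a r z) < \<rho> \<Longrightarrow> (\<lambda>n. sphere_poly a r z ^ n * (e n + z * d n)) sums K z"
proof -
  \<comment> \<open>The two points over \<open>\<zeta> = sphere_poly a r z\<close> are \<open>z = a \<plusminus> \<i> c \<zeta>\<close>; \<open>K\<close> is split into its part
    even and its part odd under exchanging them.\<close>
  define c where "c = (\<lambda>\<zeta>::complex. csqrt (of_real (r\<^sup>2) - \<zeta>))"
  \<comment> \<open>On this disc \<open>r\<^sup>2 - \<zeta>\<close> has positive real part, so
    \<open>c\<close> avoids the branch cut of the square root and has no zero.\<close>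
  let ?B = "ball (0::complex) (r\<^sup>2)"
  have pos: "of_real (r\<^sup>2) - \<zeta> \<notin> \<real>\<^sub>\<le>\<^sub>0" if "\<zeta> \<in> ?B" for \<zeta>
  proof
    assume "of_real (r\<^sup>2) - \<zeta> \<in> \<real>\<^sub>\<le>\<^sub>0"
    then have "r\<^sup>2 \<le> Re \<zeta>" by (auto simp: complex_nonpos_Reals_iff)
    then show False using that complex_Re_le_cmod[of \<zeta>] by simp
  qed
  have c: "c holomorphic_on ?B" unfolding c_def by (intro holomorphic_intros pos)
  have c2: "c \<zeta> ^ 2 = of_real (r\<^sup>2) - \<zeta>" for \<zeta> by (simp add: c_def)
  have c0: "c \<zeta> \<noteq> 0" if "\<zeta> \<in> ?B" for \<zeta> using pos[OF that] by (auto simp: c_def)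
  define u where "u = (\<lambda>\<sigma> \<zeta>. of_real a + \<sigma> * \<i> * c \<zeta>)"
  have u: "u \<sigma> holomorphic_on ?B" for \<sigma> unfolding u_def by (intro holomorphic_intros c)
  have "c 0 = r" using r by (simp add: c_def of_real_sqrt[symmetric] csqrt_of_real_nonneg power2_eq_square)
  then have "u 1 0 = Complex a r" "u (- 1) 0 = Complex a (- r)"
    by (simp_all add: u_def Complex_eq)
  moreover have op: "open (?B \<inter> u \<sigma> -` D)" for \<sigma>
    by (intro continuous_open_preimage holomorphic_on_imp_continuous_on u D) simp
  have "open ((?B \<inter> u 1 -` D) \<inter> (?B \<inter> u (- 1) -` D))" by (intro open_Int op)
  ultimately obtain \<rho> where \<rho>: "\<rho> > 0" "ball 0 \<rho> \<subseteq> (?B \<inter> u 1 -` D) \<inter> (?B \<inter> u (- 1) -` D)"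
    using D r by (force elim!: openE)
  have inB: "\<zeta> \<in> ?B" "u 1 \<zeta> \<in> D" "u (- 1) \<zeta> \<in> D" if "\<zeta> \<in> ball 0 \<rho>" for \<zeta>
    using \<rho>(2) that by auto
  have Ku: "(\<lambda>\<zeta>. K (u \<sigma> \<zeta>)) holomorphic_on ball 0 \<rho>" if "\<sigma> = 1 \<or> \<sigma> = - 1" for \<sigma>
  proof -
    have "K \<circ> u \<sigma> holomorphic_on ball 0 \<rho>"
    proof (rule holomorphic_on_compose_gen[OF _ K])
      show "u \<sigma> holomorphic_on ball 0 \<rho>" using \<rho>(2) by (intro holomorphic_on_subset[OF u]) auto
      show "u \<sigma> ` ball 0 \<rho> \<subseteq> D" using that inB by auto
    qed
    then show ?thesis by (simp add: o_def)
  qed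
  \<comment> \<open>\<open>ee\<close> and \<open>dd\<close> solve \<open>K (u \<sigma> \<zeta>) = ee
    \<zeta> + u \<sigma> \<zeta> * dd \<zeta>\<close> for both signs \<sigma>: the two points differ
    by \<open>2 * \<i> * c \<zeta>\<close> and have mean \<open>a\<close>.\<close>
  define dd where "dd = (\<lambda>\<zeta>. (K (u 1 \<zeta>) - K (u (- 1) \<zeta>)) / (2 * \<i> * c \<zeta>))"
  define ee where "ee = (\<lambda>\<zeta>. (K (u 1 \<zeta>) + K (u (- 1) \<zeta>)) / 2 - of_real a * dd \<zeta>)"
  have c': "c holomorphic_on ball 0 \<rho>" using inB by (intro holomorphic_on_subset[OF c]) auto
  have dd: "dd holomorphic_on ball 0 \<rho>" unfolding dd_def
    by (intro holomorphic_intros Ku c') (use c0 inB in auto)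
  have ee: "ee holomorphic_on ball 0 \<rho>" unfolding ee_def
    by (intro holomorphic_intros Ku dd) auto
  \<comment> \<open>Every preimage of \<zeta> is one of the two points, so smallness of the
    polynomial alone already forces \<open>z\<close> into \<open>D\<close>.\<close>
  have main: "z \<in> D \<and> K z = ee \<zeta> + z * dd \<zeta>"
    if z: "\<zeta> = sphere_poly a r z" "cmod \<zeta> < \<rho>" for z \<zeta> :: complex
  proof -
    have \<zeta>: "\<zeta> \<in> ball 0 \<rho>" using z by simp
    have "(z - of_real a)\<^sup>2 = (\<i> * c \<zeta>)\<^sup>2"
      by (simp add: power_mult_distrib c2 z(1) sphere_poly_def)
    then have "z - of_real a = \<i> * c \<zeta> \<or> z - of_real a = - (\<i> * c \<zeta>)" by (simp add: power2_eq_iff)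
    then have "z = u 1 \<zeta> \<or> z = u (- 1) \<zeta>" by (auto simp: u_def algebra_simps)
    then show ?thesis
      using inB[OF \<zeta>] c0[OF inB(1)[OF \<zeta>]]
      by (auto simp: ee_def dd_def) (simp_all add: u_def field_simps)
  qed
  show ?thesis
  proof (rule that[OF \<rho>(1)])
    fix z assume z: "cmod (sphere_poly a r z) < \<rho>"
    let ?\<zeta> = "sphere_poly a r z"
    show "z \<in> D" using main[OF refl z] by simp
    have w: "?\<zeta> \<in> ball 0 \<rho>" using z by simp
    have "(\<lambda>n. (deriv ^^ n) ee 0 / fact n * (?\<zeta> - 0) ^ n + z * ((deriv ^^ n) dd 0 / fact n * (?\<zeta> - 0) ^ n))
        sums (ee ?\<zeta> + z * dd ?\<zeta>)"
      by (intro sums_add sums_mult holomorphic_power_series[OF ee w] holomorphic_power_series[OF dd w])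
    then show "(\<lambda>n. ?\<zeta> ^ n * ((deriv ^^ n) ee 0 / fact n + z * ((deriv ^^ n) dd 0 / fact n))) sums K z"
      using main[OF refl z] by (simp add: algebra_simps)
  qed
qed

text \<open>Off \<open>q\<close> the cofactor is \<open>k1 z / (z - q) ^ m\<close>, off
  \<open>p\<close> it is \<open>k2 z / (z - p) ^ m\<close>; they agree on the overlap and
  glue.\<close>

lemma vanishes_to_two_points:
  assumes D: "open D" and pq: "p \<noteq> q" and f: "vanishes_to D p m f" "vanishes_to D q m f"
  obtains k where "k holomorphic_on D" "\<And>z. z \<in> D \<Longrightarrow> f z = ((z - p) * (z - q)) ^ m * k z"
proof -
  obtain k1 k2 where k1: "k1 holomorphic_on D" "\<And>z. z \<in> D \<Longrightarrow> f z = (z - p) ^ m * k1 z"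
    and k2: "k2 holomorphic_on D" "\<And>z. z \<in> D \<Longrightarrow> f z = (z - q) ^ m * k2 z"
    using f unfolding vanishes_to_def by blast
  define k where "k = (\<lambda>z. if z = q then k2 z / (z - p) ^ m else k1 z / (z - q) ^ m)"
  have eq: "k z = k2 z / (z - p) ^ m" if "z \<in> D - {p}" for z
    using k1(2)[of z] k2(2)[of z] that by (auto simp: k_def field_simps)
  have "(\<lambda>z. k2 z / (z - p) ^ m) holomorphic_on D - {p}"
    by (intro holomorphic_intros holomorphic_on_subset[OF k2(1)]) auto
  then have 1: "k holomorphic_on D - {p}"
    by (rule holomorphic_transform) (simp add: eq)
  have "(\<lambda>z. k1 z / (z - q) ^ m) holomorphic_on D - {q}"
    by (intro holomorphic_intros holomorphic_on_subset[OF k1(1)]) auto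
  then have 2: "k holomorphic_on D - {q}"
    by (rule holomorphic_transform) (simp add: k_def)
  have "k holomorphic_on (D - {p}) \<union> (D - {q})"
    using 1 2 D by (intro holomorphic_on_Un) auto
  moreover have "(D - {p}) \<union> (D - {q}) = D" using pq by auto
  moreover have "f z = ((z - p) * (z - q)) ^ m * k z" if "z \<in> D" for z
  proof (cases "z = q")
    case True
    then show ?thesis using k2(2)[OF that] pq by (cases "m = 0") (simp_all add: k_def power_0_left)
  next
    case False
    then show ?thesis using k1(2)[OF that] by (simp add: k_def power_mult_distrib)
  qed
  ultimately show ?thesis using that by auto
qed

text \<open>By symmetry the error also vanishes at the conjugate point, hence is divisible by
  \<open>sphere_poly a r z ^ Suc l\<close>. Expanding the quotient and shifting by
  \<open>Suc l\<close> leaves the prescribed coefficients untouched. They are made real because the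
  four components are later assembled into quaternion coefficients.\<close>

lemma symmetric_sphere_expansion:
  fixes a r :: real and \<alpha> \<beta> :: "nat \<Rightarrow> real" and G :: "complex \<Rightarrow> complex"
  assumes D: "open D" "\<And>z. z \<in> D \<Longrightarrow> cnj z \<in> D" "Complex a r \<in> D" and r: "r > 0"
    and G: "G holomorphic_on D" and sym: "\<And>z. z \<in> D \<Longrightarrow> G (cnj z) = cnj (G z)"
    and van: "vanishes_to D (Complex a r) (Suc l)
      (\<lambda>z. G z - (\<Sum>n\<le>l. sphere_poly a r z ^ n * (of_real (\<alpha> n) + z * of_real (\<beta> n))))"
  obtains \<rho> and \<alpha>' \<beta>' :: "nat \<Rightarrow> real" where "\<rho> > 0" "\<And>z. cmod (sphere_poly a r z) < \<rho> \<Longrightarrow> z \<in> D"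
    "\<And>n. n \<le> l \<Longrightarrow> \<alpha>' n = \<alpha> n" "\<And>n. n \<le> l \<Longrightarrow> \<beta>' n = \<beta> n"
    "\<And>z. cmod (sphere_poly a r z) < \<rho> \<Longrightarrow>
       (\<lambda>n. sphere_poly a r z ^ n * (of_real (\<alpha>' n) + z * of_real (\<beta>' n))) sums G z"
proof -
  define s where "s = sphere_poly a r"
  define h where "h = (\<lambda>z::complex. G z - (\<Sum>n\<le>l. s z ^ n * (of_real (\<alpha> n) + z * of_real (\<beta> n))))"
  have s_cnj: "s (cnj z) = cnj (s z)" for z by (simp add: s_def sphere_poly_def)
  have h: "vanishes_to D (Complex a r) (Suc l) h" using van by (simp add: h_def s_def)
  have "cnj (Complex a (- r)) = Complex a r" by (simp add: complex_eq_iff)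
  then have "vanishes_to D (Complex a (- r)) (Suc l) (\<lambda>z. cnj (h (cnj z)))"
    using vanishes_to_cnj_cnj[OF D(1,2), of "Complex a (- r)"] h by simp
  then have h': "vanishes_to D (Complex a (- r)) (Suc l) h"
    by (rule vanishes_to_cong) (simp add: h_def sym s_cnj)
  have "Complex a r \<noteq> Complex a (- r)" using r by simp
  then obtain K where K: "K holomorphic_on D"
    "\<And>z. z \<in> D \<Longrightarrow> h z = ((z - Complex a r) * (z - Complex a (- r))) ^ Suc l * K z"
    using vanishes_to_two_points[OF D(1) _ h h'] by blast
  have fac: "(z - Complex a r) * (z - Complex a (- r)) = s z" for z
    by (simp add: s_def sphere_poly_def complex_eq_iff power2_eq_square algebra_simps)
  have D': "Complex a (- r) \<in> D" using D(2)[OF D(3)] by (simp add: complex_cnj)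
  obtain \<rho> and e d :: "nat \<Rightarrow> complex" where \<rho>: "\<rho> > 0" "\<And>z. cmod (s z) < \<rho> \<Longrightarrow> z \<in> D"
    and Ks: "\<And>z. cmod (s z) < \<rho> \<Longrightarrow> (\<lambda>n. s z ^ n * (e n + z * d n)) sums K z"
    by (rule sphere_expansion[OF D(1,3) D' r K(1), folded s_def]) (rule that, auto)
  \<comment> \<open>Indices up to \<open>l\<close> keep the prescribed values; from
    \<open>Suc l\<close> on the expansion of the quotient takes over.\<close>
  define e' where "e' = (\<lambda>n. if n \<le> l then of_real (\<alpha> n) else e (n - Suc l))"
  define d' where "d' = (\<lambda>n. if n \<le> l then of_real (\<beta> n) else d (n - Suc l))"
  have Gs: "(\<lambda>n. s z ^ n * (e' n + z * d' n)) sums G z" if z: "cmod (s z) < \<rho>" for z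
  proof -
    have "(\<lambda>n. s z ^ Suc l * (s z ^ n * (e n + z * d n))) sums (s z ^ Suc l * K z)"
      by (rule sums_mult[OF Ks[OF z]])
    then have "(\<lambda>n. s z ^ (n + Suc l) * (e' (n + Suc l) + z * d' (n + Suc l))) sums h z"
      using K(2)[OF \<rho>(2)[OF z]] unfolding fac
      by (simp add: e'_def d'_def power_add algebra_simps)
    then have "(\<lambda>n. s z ^ n * (e' n + z * d' n)) sums
        (h z + (\<Sum>n<Suc l. s z ^ n * (e' n + z * d' n)))"
      by (subst (asm) sums_iff_shift)
    moreover have "(\<Sum>n<Suc l. s z ^ n * (e' n + z * d' n)) = (\<Sum>n\<le>l. s z ^ n * (of_real (\<alpha> n) + z * of_real (\<beta> n)))"
      by (rule sum.cong) (auto simp: e'_def d'_def)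
    ultimately show ?thesis by (simp add: h_def)
  qed
  show ?thesis
  proof (rule that[of \<rho> "\<lambda>n. Re (e' n)" "\<lambda>n. Re (d' n)", OF \<rho>(1), folded s_def])
    fix z assume z: "cmod (s z) < \<rho>"
    show "z \<in> D" by (rule \<rho>(2)[OF z])
    have "(\<lambda>n. s (cnj z) ^ n * (e' n + cnj z * d' n)) sums G (cnj z)"
      by (rule Gs) (use z in \<open>simp add: s_cnj\<close>)
    then have "(\<lambda>n. cnj (s (cnj z) ^ n * (e' n + cnj z * d' n))) sums cnj (G (cnj z))"
      by (subst sums_cnj)
    then have "(\<lambda>n. s z ^ n * (cnj (e' n) + z * cnj (d' n))) sums G z"
      using sym[OF \<rho>(2)[OF z]] by (simp add: s_cnj)
    \<comment> \<open>Averaging the two expansions makes the coefficients real.\<close>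
    from sums_divide[OF sums_add[OF Gs[OF z] this], of 2]
    have "(\<lambda>n. (s z ^ n * ((e' n + cnj (e' n)) + z * (d' n + cnj (d' n)))) / 2) sums G z"
      by (simp add: algebra_simps)
    then show "(\<lambda>n. s z ^ n * (of_real (Re (e' n)) + z * of_real (Re (d' n)))) sums G z"
      unfolding complex_add_cnj by (simp add: algebra_simps add_divide_distrib)
  qed (auto simp: e'_def d'_def)
qed

section \<open>Slice planes as copies of the complex field\<close>

definition slice_embed :: "quat \<Rightarrow> complex \<Rightarrow> quat" where
  "slice_embed J w = qreal (Re w) + Im w *\<^sub>R J"

lemma slice_embed_add: "slice_embed J (w + v) = slice_embed J w + slice_embed J v"
  by (simp add: slice_embed_def vec_eq_iff forall_4 algebra_simps)

lemma slice_embed_diff: "slice_embed J (w - v) = slice_embed J w - slice_embed J v"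
  by (simp add: slice_embed_def vec_eq_iff forall_4 algebra_simps)

lemma slice_embed_of_real: "slice_embed J (of_real x) = qreal x"
  by (simp add: slice_embed_def)

lemma slice_embed_mult:
  assumes "J \<in> sphS"
  shows "slice_embed J (w * v) = slice_embed J w \<star> slice_embed J v"
proof -
  have J: "J \<star> J = - qreal 1" using assms by (simp add: sphS_def)
  have "slice_embed J w \<star> slice_embed J v = qreal (Re w * Re v) + (Re w * Im v + Im w * Re v) *\<^sub>R J
      + (Im w * Im v) *\<^sub>R (J \<star> J)"
    by (simp add: slice_embed_def vec_eq_iff forall_4 qmul_nth algebra_simps)
  also have "\<dots> = slice_embed J (w * v)"
    unfolding J by (simp add: slice_embed_def vec_eq_iff forall_4 algebra_simps)
  finally show ?thesis ..
qed

lemma slice_embed_power: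
  assumes "J \<in> sphS" shows "slice_embed J (w ^ n) = qpow (slice_embed J w) n"
proof (induction n)
  case 0
  then show ?case by (simp add: slice_embed_def)
next
  case (Suc n)
  then show ?case by (simp add: slice_embed_mult[OF assms])
qed

text \<open>Here the position of the coefficient matters: with the constant on the right, the
  product by an element of the slice plane is computed in each component.\<close>

lemma slice_value_embed:
  "slice_value J (\<lambda>m. w * of_real (c $ m)) = slice_embed J w \<star> c"
  by (simp add: slice_value_def slice_embed_def vec_eq_iff forall_4 qmul_nth algebra_simps)

lemma slice_value_add:
  "slice_value J (\<lambda>m. w m + v m) = slice_value J w + slice_value J v"
  by (simp add: slice_value_def vec_eq_iff forall_4 qmul_nth algebra_simps)

lemma sphere_term_slice:
  fixes \<alpha> \<beta> q0 :: quat
  assumes J: "J \<in> sphS" and q: "q = slice_embed J z"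
  shows "qpow ((q - qreal a) \<star> (q - qreal a) + qreal (r\<^sup>2)) n \<star> (\<alpha> + q0 \<star> \<beta> + (q - q0) \<star> \<beta>) =
    slice_value J (\<lambda>m. sphere_poly a r z ^ n * (of_real (\<alpha> $ m) + z * of_real (\<beta> $ m)))"
proof -
  have "(q - qreal a) \<star> (q - qreal a) + qreal (r\<^sup>2) = slice_embed J (sphere_poly a r z)"
    unfolding sphere_poly_def q power2_eq_square of_real_mult[symmetric]
    by (simp only: slice_embed_add slice_embed_mult[OF J] slice_embed_diff slice_embed_of_real)
  then have "qpow ((q - qreal a) \<star> (q - qreal a) + qreal (r\<^sup>2)) n = slice_embed J (sphere_poly a r z ^ n)"
    by (simp add: slice_embed_power[OF J])
  moreover have "\<alpha> + q0 \<star> \<beta> + (q - q0) \<star> \<beta> = \<alpha> + q \<star> \<beta>" by (simp add: qmul_distrib)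
  moreover have "slice_embed J w \<star> (\<alpha> + q \<star> \<beta>) =
      slice_value J (\<lambda>m. w * (of_real (\<alpha> $ m) + z * of_real (\<beta> $ m)))" for w
  proof -
    have "slice_embed J w \<star> (\<alpha> + q \<star> \<beta>) = slice_embed J w \<star> \<alpha> + slice_embed J (w * z) \<star> \<beta>"
      by (simp add: qmul_distrib q qmul_assoc[symmetric] slice_embed_mult[OF J])
    then show ?thesis
      by (simp only: slice_value_embed[symmetric] slice_value_add[symmetric] distrib_left mult.assoc)
  qed
  ultimately show ?thesis by (simp only:)
qed

text \<open>Each component is expanded separately; as all coefficients are real, the four series
  combine into one series with quaternion coefficients on the right.\<close>

lemma has_sph_jet_of_components:
  fixes A :: "nat \<Rightarrow> quat"
  assumes \<Omega>: "open \<Omega>" "axially_symmetric \<Omega>" and G: "\<And>m. G m holomorphic_on {z. qcx z \<in> \<Omega>}"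
    and sym: "\<And>m z. qcx z \<in> \<Omega> \<Longrightarrow> G m (cnj z) = cnj (G m z)"
    and f: "slice_rep \<Omega> f G" and q0: "q0 \<in> \<Omega>" "qim q0 \<noteq> 0"
    and a: "qre q0 = a" and r: "norm (qim q0) = r"
    and van: "\<And>m. vanishes_to {z. qcx z \<in> \<Omega>} (Complex a r) (Suc l)
      (\<lambda>z. G m z - (\<Sum>n\<le>l. sphere_poly a r z ^ n *
        (of_real ((A (2 * n) - q0 \<star> A (2 * n + 1)) $ m) + z * of_real (A (2 * n + 1) $ m))))"
  shows "has_sph_jet \<Omega> f q0 l A"
proof -
  let ?D = "{z. qcx z \<in> \<Omega>}"
  have D: "open ?D" by (rule open_stem_domain[OF \<Omega>(1)])
  have Dcnj: "cnj z \<in> ?D" if "z \<in> ?D" for z using that by (simp add: qcx_cnj_iff[OF \<Omega>(2)])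
  have p: "Complex a r \<in> ?D"
    using slice_coord_in_stem_domain[OF \<Omega>(2) q0(1)] by (simp add: slice_coord_def a r)
  have r0: "r > 0" using q0(2) r by auto
  define P where "P = (\<lambda>m \<rho> (\<alpha> :: nat \<Rightarrow> real) (\<beta> :: nat \<Rightarrow> real).
      \<rho> > 0 \<and> (\<forall>z. cmod (sphere_poly a r z) < \<rho> \<longrightarrow> z \<in> ?D) \<and>
      (\<forall>n\<le>l. \<alpha> n = (A (2 * n) - q0 \<star> A (2 * n + 1)) $ m \<and> \<beta> n = A (2 * n + 1) $ m) \<and>
      (\<forall>z. cmod (sphere_poly a r z) < \<rho> \<longrightarrow>
        (\<lambda>n. sphere_poly a r z ^ n * (of_real (\<alpha> n) + z * of_real (\<beta> n))) sums G m z))"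
  have "\<exists>\<rho> \<alpha> \<beta>. P m \<rho> \<alpha> \<beta>" for m
  proof -
    have symD: "G m (cnj z) = cnj (G m z)" if "z \<in> ?D" for z using sym that by simp
    show ?thesis
      apply (rule symmetric_sphere_expansion[OF D Dcnj p r0 G symD van])
      apply assumption
      apply assumption
      subgoal for \<rho> \<alpha> \<beta>
        by (rule exI[of _ \<rho>], rule exI[of _ \<alpha>], rule exI[of _ \<beta>]) (unfold P_def, intro conjI allI impI; blast)
      done
  qed
  then obtain \<rho> \<alpha> \<beta> where P: "\<And>m. P m (\<rho> m) (\<alpha> m) (\<beta> m)" by metis
  have \<rho>: "\<rho> m > 0" "cmod (sphere_poly a r z) < \<rho> m \<Longrightarrow> z \<in> ?D"
    and \<alpha>: "n \<le> l \<Longrightarrow> \<alpha> m n = (A (2 * n) - q0 \<star> A (2 * n + 1)) $ m"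
    and \<beta>: "n \<le> l \<Longrightarrow> \<beta> m n = A (2 * n + 1) $ m"
    and Gs: "cmod (sphere_poly a r z) < \<rho> m \<Longrightarrow>
        (\<lambda>n. sphere_poly a r z ^ n * (of_real (\<alpha> m n) + z * of_real (\<beta> m n))) sums G m z" for m n z
    using P[of m] unfolding P_def by blast+
  \<comment> \<open>The four expansions come with different radii; the least one serves all of
    them.\<close>
  define \<epsilon> where "\<epsilon> = Min (range \<rho>)"
  have \<epsilon>: "\<epsilon> > 0" "\<epsilon> \<le> \<rho> m" for m unfolding \<epsilon>_def using \<rho>(1) by (auto simp: Min_gr_iff)
  define U where "U = {q. cmod (sphere_poly a r (slice_coord q)) < \<epsilon>}"
  define \<alpha>' where "\<alpha>' = (\<lambda>n. (\<chi> m. \<alpha> m n) :: quat)"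
  define \<beta>' where "\<beta>' = (\<lambda>n. (\<chi> m. \<beta> m n) :: quat)"
  \<comment> \<open>Undoes the shift by \<open>q0\<close> at all indices, including those past the
    prescribed jet.\<close>
  define B where "B = (\<lambda>k. if even k then \<alpha>' (k div 2) + q0 \<star> \<beta>' (k div 2) else \<beta>' (k div 2))"
  have "open U"
    unfolding U_def sphere_poly_def
    by (intro open_Collect_less continuous_intros continuous_slice_coord)
  moreover have "U \<subseteq> \<Omega>"
  proof
    fix q assume "q \<in> U"
    then have "cmod (sphere_poly a r (slice_coord q)) < \<rho> 1" using \<epsilon>(2)[of 1] by (simp add: U_def)
    then have "qcx (slice_coord q) \<in> \<Omega>" using \<rho>(2) by blast
    then show "q \<in> \<Omega>" by (simp add: qcx_slice_coord_iff[OF \<Omega>(2)])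
  qed
  moreover have "qsphere (qre q0) (norm (qim q0)) \<subseteq> U"
  proof
    fix q assume "q \<in> qsphere (qre q0) (norm (qim q0))"
    then obtain J where "J \<in> sphS" "q = qreal a + r *\<^sub>R J" unfolding qsphere_def a r by blast
    then have "slice_coord q = Complex a r" using slice_coord_slice r0 by simp
    moreover have "sphere_poly a r (Complex a r) = 0"
      by (simp add: sphere_poly_def complex_eq_iff power2_eq_square)
    ultimately show "q \<in> U" using \<epsilon>(1) by (simp add: U_def)
  qed
  moreover have "\<forall>k\<le>2 * l + 1. B k = A k"
  proof (intro allI impI)
    fix k assume k: "k \<le> 2 * l + 1"
    then have kl: "k div 2 \<le> l" by linarith
    have \<beta>A: "\<beta>' (k div 2) = A (2 * (k div 2) + 1)"
      by (simp add: \<beta>'_def vec_eq_iff \<beta>[OF kl])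
    have \<alpha>A: "\<alpha>' (k div 2) = A (2 * (k div 2)) - q0 \<star> A (2 * (k div 2) + 1)"
      by (simp add: \<alpha>'_def vec_eq_iff \<alpha>[OF kl])
    show "B k = A k"
    proof (cases "even k")
      case True
      then show ?thesis unfolding B_def \<alpha>A \<beta>A by simp
    next
      case False
      then have "2 * (k div 2) + 1 = k" by (rule odd_two_times_div_two_succ)
      then show ?thesis using False unfolding B_def \<beta>A by simp
    qed
  qed
  moreover have "\<forall>q\<in>U. (\<lambda>n. qpow ((q - qreal (qre q0)) \<star> (q - qreal (qre q0)) + qreal ((norm (qim q0))\<^sup>2)) n
      \<star> (B (2 * n) + (q - q0) \<star> B (2 * n + 1))) sums f q"
  proof
    fix q assume q: "q \<in> U"
    let ?z = "slice_coord q"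
    obtain J where J: "J \<in> sphS" "q = qreal (Re ?z) + Im ?z *\<^sub>R J" using slice_decomposition .
    have z: "cmod (sphere_poly a r ?z) < \<rho> m" for m
      using q \<epsilon>(2)[of m] by (simp add: U_def)
    have "(\<lambda>n. slice_value J (\<lambda>m. sphere_poly a r ?z ^ n *
        (of_real (\<alpha>' n $ m) + ?z * of_real (\<beta>' n $ m)))) sums slice_value J (\<lambda>m. G m ?z)"
      by (rule sums_slice_value) (simp add: \<alpha>'_def \<beta>'_def Gs[OF z])
    moreover have "f q = slice_value J (\<lambda>m. G m ?z)"
      using f J \<open>U \<subseteq> \<Omega>\<close> q unfolding slice_rep_def by (metis complex.collapse subsetD)
    moreover have "q = slice_embed J ?z" using J(2) by (simp add: slice_embed_def)
    ultimately show "(\<lambda>n. qpow ((q - qreal (qre q0)) \<star> (q - qreal (qre q0)) + qreal ((norm (qim q0))\<^sup>2)) n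
        \<star> (B (2 * n) + (q - q0) \<star> B (2 * n + 1))) sums f q"
      using sphere_term_slice[OF J(1), of q ?z a r _ "\<alpha>' _" q0 "\<beta>' _"] by (simp add: B_def a r)
  qed
  ultimately show ?thesis unfolding has_sph_jet_def by blast
qed

subsection \<open>Interpolation by slice-regular functions\<close>

lemma norm_slice_coord: "cmod (slice_coord q) = norm q"
  unfolding slice_coord_def cmod_def by (simp add: norm_quat qre_def)

lemma qsphere_iff:
  assumes "r \<ge> 0" shows "q \<in> qsphere a r \<longleftrightarrow> slice_coord q = Complex a r"
proof
  assume "q \<in> qsphere a r"
  then show "slice_coord q = Complex a r"
    using assms slice_coord_slice unfolding qsphere_def by auto
next
  assume q: "slice_coord q = Complex a r"
  obtain J where "J \<in> sphS" "q = qreal (Re (slice_coord q)) + Im (slice_coord q) *\<^sub>R J"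
    using slice_decomposition .
  then show "q \<in> qsphere a r" unfolding q qsphere_def by auto
qed

text \<open>\<open>slice_coord\<close> is continuous and preserves norms, hence proper: the preimage
  of a closed ball in the stem domain is a compact subset of \<Omega>, which meets \<open>W\<close>
  in a finite set.\<close>

lemma locally_finite_slice_coord:
  assumes \<Omega>: "open \<Omega>" "axially_symmetric \<Omega>" and W: "locally_finite_subset \<Omega> W"
  shows "locally_finite_subset {z. qcx z \<in> \<Omega>} (slice_coord ` W)"
  unfolding locally_finite_subset_def
proof (intro conjI ballI)
  show "slice_coord ` W \<subseteq> {z. qcx z \<in> \<Omega>}"
    using W slice_coord_in_stem_domain[OF \<Omega>(2)] unfolding locally_finite_subset_def by auto
  fix z assume "z \<in> {z. qcx z \<in> \<Omega>}"
  then obtain e where e: "e > 0" "cball z e \<subseteq> {z. qcx z \<in> \<Omega>}"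
    using open_stem_domain[OF \<Omega>(1)] open_contains_cball by blast
  define C where "C = {q. slice_coord q \<in> cball z e}"
  have "closed C"
    unfolding C_def using continuous_closed_vimage[OF closed_cball, of slice_coord z e]
      continuous_slice_coord by (simp add: vimage_def continuous_on_eq_continuous_at)
  moreover have "bounded C"
  proof -
    have "norm q \<le> norm z + e" if "q \<in> C" for q
    proof -
      have "norm q = norm (z - (z - slice_coord q))" by (simp add: norm_slice_coord)
      also have "\<dots> \<le> norm z + norm (z - slice_coord q)" by (rule norm_triangle_ineq4)
      also have "\<dots> \<le> norm z + e" using that by (simp add: C_def dist_norm)
      finally show ?thesis .
    qed
    then show ?thesis by (auto simp: bounded_iff)
  qed
  ultimately have "compact C" by (simp add: compact_eq_bounded_closed)
  moreover have "C \<subseteq> \<Omega>"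
  proof
    fix q assume "q \<in> C"
    then have "qcx (slice_coord q) \<in> \<Omega>" using e(2) by (auto simp: C_def)
    then show "q \<in> \<Omega>" by (simp add: qcx_slice_coord_iff[OF \<Omega>(2)])
  qed
  ultimately have "finite (slice_coord ` (W \<inter> C))"
    using locally_finite_subset_compact[OF W] by simp
  moreover have "slice_coord ` W \<inter> ball z e \<subseteq> slice_coord ` (W \<inter> C)"
    unfolding C_def using ball_subset_cball by blast
  ultimately show "\<exists>e>0. finite (slice_coord ` W \<inter> ball z e)"
    using e(1) finite_subset by blast
qed

lemma slice_regular_interpolation:
  fixes t :: "complex \<Rightarrow> 4 \<Rightarrow> complex \<Rightarrow> complex"
  assumes \<Omega>: "open \<Omega>" "axially_symmetric \<Omega>"
    and P: "locally_finite_subset {z. qcx z \<in> \<Omega>} P" and Im: "\<And>p. p \<in> P \<Longrightarrow> Im p \<ge> 0"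
    and t: "\<And>p m. p \<in> P \<Longrightarrow> t p m holomorphic_on {z. qcx z \<in> \<Omega>}"
    and real: "\<And>p m z. p \<in> P \<Longrightarrow> Im p = 0 \<Longrightarrow> t p m (cnj z) = cnj (t p m z)"
  obtains f G where "slice_regular \<Omega> f" "slice_rep \<Omega> f G"
    "\<And>m. G m holomorphic_on {z. qcx z \<in> \<Omega>}" "\<And>m z. qcx z \<in> \<Omega> \<Longrightarrow> G m (cnj z) = cnj (G m z)"
    "\<And>p m. p \<in> P \<Longrightarrow> vanishes_to {z. qcx z \<in> \<Omega>} p (N p) (\<lambda>z. G m z - t p m z)"
proof -
  let ?D = "{z. qcx z \<in> \<Omega>}"
  define R where "R = (\<lambda>m g. g holomorphic_on ?D \<and> (\<forall>z\<in>?D. g (cnj z) = cnj (g z)) \<and>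
    (\<forall>p\<in>P. vanishes_to ?D p (N p) (\<lambda>z. g z - t p m z)))"
  have "\<exists>g. R m g" for m
  proof -
    obtain g where "g holomorphic_on ?D" "\<And>z. z \<in> ?D \<Longrightarrow> g (cnj z) = cnj (g z)"
      "\<And>p. p \<in> P \<Longrightarrow> vanishes_to ?D p (N p) (\<lambda>z. g z - t p m z)"
    proof (rule symmetric_jet_interpolation[where D = ?D and P = P and t = "\<lambda>p. t p m" and m = N])
      show "open ?D" by (rule open_stem_domain[OF \<Omega>(1)])
      show "cnj z \<in> ?D" if "z \<in> ?D" for z using that by (simp add: qcx_cnj_iff[OF \<Omega>(2)])
    qed (use P Im t real in auto)
    then show ?thesis unfolding R_def by blast
  qed
  then obtain G where "\<And>m. R m (G m)" by metis
  then have G: "G m holomorphic_on ?D" "qcx z \<in> \<Omega> \<Longrightarrow> G m (cnj z) = cnj (G m z)"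
    "p \<in> P \<Longrightarrow> vanishes_to ?D p (N p) (\<lambda>z. G m z - t p m z)" for m z p
    unfolding R_def by auto
  obtain f where f: "slice_rep \<Omega> f G" using slice_rep_exists[of \<Omega> G, OF \<Omega>(2) G(2)] .
  have "slice_regular \<Omega> f" by (rule slice_regular_of_components[OF G(1,2) f])
  then show ?thesis using that f G by blast
qed

theorem theorem2:
  fixes \<Omega> :: "quat set"
    and SS :: "(real \<times> real) set"   \<comment> \<open>spheres a + r S, given by (a, r)\<close>
    and X :: "real set"               \<comment> \<open>real points\<close>
    and Zp :: "quat set"              \<comment> \<open>nonreal points\<close>
    and lX :: "real \<Rightarrow> nat" and AX :: "real \<Rightarrow> nat \<Rightarrow> quat"
    and lZ :: "quat \<Rightarrow> nat" and AZ :: "quat \<Rightarrow> nat \<Rightarrow> quat"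
    and lS :: "real \<times> real \<Rightarrow> nat" and AS :: "real \<times> real \<Rightarrow> nat \<Rightarrow> quat"
  assumes dom: "axially_symmetric_domain \<Omega>"
    and rpos: "\<forall>(a, r)\<in>SS. r > 0"
    and nonreal: "\<forall>z\<in>Zp. qim z \<noteq> 0"
    and one_per_sphere: "\<forall>x y. \<forall>z\<in>Zp. \<forall>w\<in>Zp. z \<in> qsphere x y \<longrightarrow> w \<in> qsphere x y \<longrightarrow> z = w"
    and sub: "(\<forall>(a, r)\<in>SS. qsphere a r \<subseteq> \<Omega>) \<and> qreal ` X \<subseteq> \<Omega> \<and> Zp \<subseteq> \<Omega>"
    and discrete: "\<forall>p\<in>\<Omega>. \<exists>e>0.
                     finite {(a, r)\<in>SS. qsphere a r \<inter> ball p e \<noteq> {}} \<and>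
                     finite {x\<in>X. qreal x \<in> ball p e} \<and>
                     finite (Zp \<inter> ball p e)"
    and sph_even: "\<forall>(a, r)\<in>SS. Zp \<inter> qsphere a r = {} \<longrightarrow>
                     (\<forall>k\<le>2 * lS (a, r) + 1. odd k \<longrightarrow> AS (a, r) k = 0)"
  shows "\<exists>f. slice_regular \<Omega> f \<and>
           (\<forall>x\<in>X. has_jet f (qreal x) (lX x) (AX x)) \<and>
           (\<forall>z\<in>Zp. (\<forall>(a, r)\<in>SS. z \<notin> qsphere a r) \<longrightarrow> has_jet f z (lZ z) (AZ z)) \<and>
           (\<forall>(a, r)\<in>SS. \<forall>z\<in>Zp. z \<in> qsphere a r \<longrightarrow>
                has_sph_jet \<Omega> f z (lS (a, r)) (AS (a, r))) \<and>
           (\<forall>(a, r)\<in>SS. Zp \<inter> qsphere a r = {} \<longrightarrow>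
                has_sph_jet \<Omega> f (qreal a + r *\<^sub>R qi) (lS (a, r)) (AS (a, r)))"
proof -
  have \<Omega>: "open \<Omega>" "axially_symmetric \<Omega>" using dom by (simp_all add: axially_symmetric_domain_def)
  let ?D = "{z. qcx z \<in> \<Omega>}"
  \<comment> \<open>One representative per sphere; a point of \<open>Zp\<close> on that sphere has
    the same slice coordinate, so it yields no further interpolation node.\<close>
  define W where "W = (\<lambda>(a, r). qcx (Complex a r)) ` SS \<union> qreal ` X \<union> Zp"
  define P where "P = slice_coord ` W"
  have rp: "r > 0" if "(a, r) \<in> SS" for a r using rpos that by auto
  have in_sphere: "q \<in> qsphere a r \<longleftrightarrow> slice_coord q = Complex a r" if "(a, r) \<in> SS" for a r q
    using qsphere_iff rp[OF that] by simp
  have same: "z = w" if "z \<in> Zp" "w \<in> Zp" "slice_coord z = slice_coord w" for z w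
  proof -
    define c where "c = slice_coord w"
    have "Im c \<ge> 0" by (simp add: c_def slice_coord_def)
    then have "z \<in> qsphere (Re c) (Im c)" "w \<in> qsphere (Re c) (Im c)"
      using that by (simp_all add: qsphere_iff c_def)
    then show ?thesis using one_per_sphere that by blast
  qed
  have ImZ: "Im (slice_coord z) > 0" if "z \<in> Zp" for z
    using nonreal that by (simp add: slice_coord_def)
  have sc_qcx: "slice_coord (qcx (Complex a r)) = Complex a r" if "(a, r) \<in> SS" for a r
    using slice_coord_slice[OF qi_in_sphS, of a r] rp[OF that] by (simp add: qcx_eq)
  have sc_real: "slice_coord (qreal x) = of_real x" for x
    using slice_coord_slice[OF qi_in_sphS, of x 0] by (simp add: complex_eq_iff)
  have qcx_sphere: "qcx (Complex a r) \<in> qsphere a r" if "(a, r) \<in> SS" for a r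
    using in_sphere[OF that] sc_qcx[OF that] by simp
  have sph_sub: "qsphere a r \<subseteq> \<Omega>" if "(a, r) \<in> SS" for a r using sub that by auto
  have W: "locally_finite_subset \<Omega> W"
    unfolding locally_finite_subset_def
  proof (intro conjI ballI)
    have "qcx (Complex a r) \<in> \<Omega>" if "(a, r) \<in> SS" for a r
      using sph_sub[OF that] qcx_sphere[OF that] by blast
    then show "W \<subseteq> \<Omega>" using sub by (auto simp: W_def)
    fix p assume "p \<in> \<Omega>"
    then obtain e where e: "e > 0" "finite {(a, r)\<in>SS. qsphere a r \<inter> ball p e \<noteq> {}}"
      "finite {x\<in>X. qreal x \<in> ball p e}" "finite (Zp \<inter> ball p e)"
      using discrete by blast
    have "W \<inter> ball p e \<subseteq> (\<lambda>(a, r). qcx (Complex a r)) ` {(a, r)\<in>SS. qsphere a r \<inter> ball p e \<noteq> {}}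
        \<union> qreal ` {x\<in>X. qreal x \<in> ball p e} \<union> (Zp \<inter> ball p e)"
    proof
      fix q assume q: "q \<in> W \<inter> ball p e"
      then consider (S) a r where "(a, r) \<in> SS" "q = qcx (Complex a r)" | "q \<in> qreal ` X" | "q \<in> Zp"
        unfolding W_def by auto
      then show "q \<in> (\<lambda>(a, r). qcx (Complex a r)) ` {(a, r)\<in>SS. qsphere a r \<inter> ball p e \<noteq> {}}
        \<union> qreal ` {x\<in>X. qreal x \<in> ball p e} \<union> (Zp \<inter> ball p e)"
      proof cases
        case S
        then have "(a, r) \<in> {(a, r)\<in>SS. qsphere a r \<inter> ball p e \<noteq> {}}"
          using q qcx_sphere[OF S(1)] by auto
        then show ?thesis using S(2) by (metis (no_types, lifting) UnI1 case_prod_conv image_eqI)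
      qed (use q in auto)
    qed
    then have "finite (W \<inter> ball p e)" by (rule finite_subset) (intro finite_UnI finite_imageI e)
    then show "\<exists>e>0. finite (W \<inter> ball p e)" using e(1) by blast
  qed
  have P: "locally_finite_subset ?D P" unfolding P_def by (rule locally_finite_slice_coord[OF \<Omega> W])
  have ImP: "Im p \<ge> 0" if "p \<in> P" for p using that by (auto simp: P_def slice_coord_def)
  \<comment> \<open>All requirements of the conclusion that sit over the node
    \<open>p\<close>.\<close>
  define jets where "jets = (\<lambda>p f.
    (\<forall>x\<in>X. p = of_real x \<longrightarrow> has_jet f (qreal x) (lX x) (AX x)) \<and>
    (\<forall>z\<in>Zp. p = slice_coord z \<longrightarrow> (\<forall>(a, r)\<in>SS. z \<notin> qsphere a r) \<longrightarrow> has_jet f z (lZ z) (AZ z)) \<and>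
    (\<forall>(a, r)\<in>SS. p = Complex a r \<longrightarrow>
      (\<forall>z\<in>Zp. z \<in> qsphere a r \<longrightarrow> has_sph_jet \<Omega> f z (lS (a, r)) (AS (a, r))) \<and>
      (Zp \<inter> qsphere a r = {} \<longrightarrow> has_sph_jet \<Omega> f (qreal a + r *\<^sub>R qi) (lS (a, r)) (AS (a, r)))))"
  define fits where "fits = (\<lambda>p N (t :: 4 \<Rightarrow> complex \<Rightarrow> complex) f. \<exists>G. slice_rep \<Omega> f G \<and>
    (\<forall>m. G m holomorphic_on ?D) \<and> (\<forall>m z. qcx z \<in> \<Omega> \<longrightarrow> G m (cnj z) = cnj (G m z)) \<and>
    (\<forall>m. vanishes_to ?D p N (\<lambda>z. G m z - t m z)))"
  \<comment> \<open>The order and target at \<open>p\<close> are good if contact to that order alone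
    forces the requirements over \<open>p\<close>; each node can then be settled without knowing the
    function that serves all of them.\<close>
  define good where "good = (\<lambda>p N t. (\<forall>m. t m holomorphic_on ?D) \<and>
    (Im p = 0 \<longrightarrow> (\<forall>m z. t m (cnj z) = cnj (t m z))) \<and> (\<forall>f. fits p N t f \<longrightarrow> jets p f))"
  have "\<exists>N t. good p N t" if "p \<in> P" for p
  proof -
    have cov: "p \<in> (\<lambda>(a, r). Complex a r) ` SS \<union> of_real ` X \<union> slice_coord ` Zp"
      using that sc_qcx sc_real unfolding P_def W_def by force
    \<comment> \<open>Spheres take precedence: the last case keeps only points of \<open>Zp\<close>
      on no prescribed sphere, which are the ones carrying a point jet.\<close>
    consider (S) a r where "(a, r) \<in> SS" "p = Complex a r"
      | (X) x where "x \<in> X" "p = of_real x" "\<And>a r. (a, r) \<in> SS \<Longrightarrow> p \<noteq> Complex a r"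
      | (Z) w where "w \<in> Zp" "p = slice_coord w" "\<And>a r. (a, r) \<in> SS \<Longrightarrow> p \<noteq> Complex a r"
    proof (cases "\<exists>a r. (a, r) \<in> SS \<and> p = Complex a r")
      case True
      then show ?thesis using that(1) by blast
    next
      case False
      then have "p \<in> of_real ` X \<or> p \<in> slice_coord ` Zp" using cov by auto
      then show ?thesis using that(2,3) False by blast
    qed
    then show ?thesis
    proof cases
      case S
      \<comment> \<open>The centre of the spherical jet: the point of \<open>Zp\<close> on the
        sphere if there is one, otherwise the representative \<open>qreal a + r *\<^sub>R qi\<close>
        used in the conclusion.\<close>
      define q0 where "q0 = (if \<exists>z\<in>Zp. z \<in> qsphere a r then SOME z. z \<in> Zp \<and> z \<in> qsphere a r
        else qreal a + r *\<^sub>R qi)"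
      have q0Z: "q0 \<in> Zp \<and> q0 \<in> qsphere a r" if "z \<in> Zp" "z \<in> qsphere a r" for z
      proof -
        have "\<exists>z. z \<in> Zp \<and> z \<in> qsphere a r" using that by blast
        from someI_ex[OF this] show ?thesis using that by (auto simp: q0_def)
      qed
      have q0S: "q0 \<in> qsphere a r"
      proof (cases "\<exists>z\<in>Zp. z \<in> qsphere a r")
        case True
        then show ?thesis using q0Z by blast
      next
        case False
        then show ?thesis using qcx_sphere[OF S(1)] by (simp add: q0_def qcx_eq)
      qed
      then have sc: "slice_coord q0 = Complex a r" using in_sphere[OF S(1)] by simp
      then have q0: "qre q0 = a" "norm (qim q0) = r" by (simp_all add: slice_coord_def)
      define A where "A = AS (a, r)"
      define t where "t = (\<lambda>(m::4) z. \<Sum>n\<le>lS (a, r). sphere_poly a r z ^ n *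
        (of_real ((A (2 * n) - q0 \<star> A (2 * n + 1)) $ m) + z * of_real (A (2 * n + 1) $ m)))"
      have "has_sph_jet \<Omega> f q0 (lS (a, r)) A" if fit: "fits p (Suc (lS (a, r))) t f" for f
      proof -
        obtain G where G: "slice_rep \<Omega> f G" "\<And>m. G m holomorphic_on ?D"
          "\<And>m z. qcx z \<in> \<Omega> \<Longrightarrow> G m (cnj z) = cnj (G m z)"
          "\<And>m. vanishes_to ?D p (Suc (lS (a, r))) (\<lambda>z. G m z - t m z)"
          using fit unfolding fits_def by blast
        show ?thesis
        proof (rule has_sph_jet_of_components[OF \<Omega> G(2,3,1) _ _ q0])
          show "q0 \<in> \<Omega>" using q0S sph_sub[OF S(1)] by blast
          show "qim q0 \<noteq> 0" using q0(2) rp[OF S(1)] by auto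
        qed (use G(4) S(2) in \<open>simp_all add: t_def\<close>)
      qed
      moreover have "jets p f" if f: "has_sph_jet \<Omega> f q0 (lS (a, r)) A" for f
      proof -
        have nX: "p \<noteq> of_real x" for x using S(2) rp[OF S(1)] by (auto simp: complex_eq_iff)
        have nZ: "z \<in> qsphere a r" if "p = slice_coord z" for z
          using in_sphere[OF S(1)] that S(2) by simp
        have 1: "has_sph_jet \<Omega> f z (lS (a, r)) (AS (a, r))" if "z \<in> Zp" "z \<in> qsphere a r" for z
        proof -
          have "z = q0" using same[OF that(1)] q0Z[OF that] in_sphere[OF S(1)] that(2) by simp
          then show ?thesis using f by (simp add: A_def)
        qed
        have 2: "has_sph_jet \<Omega> f (qreal a + r *\<^sub>R qi) (lS (a, r)) (AS (a, r))"
          if "Zp \<inter> qsphere a r = {}"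
        proof -
          have "q0 = qreal a + r *\<^sub>R qi" using that by (auto simp: q0_def)
          then show ?thesis using f by (simp add: A_def)
        qed
        show ?thesis unfolding jets_def
        proof (intro conjI ballI impI)
          fix z assume z: "p = slice_coord z" "\<forall>(a, r)\<in>SS. z \<notin> qsphere a r"
          then have False using nZ[OF z(1)] S(1) by auto
          then show "has_jet f z (lZ z) (AZ z)" ..
        next
          fix s assume "s \<in> SS"
          show "case s of (a, r) \<Rightarrow> p = Complex a r \<longrightarrow>
            (\<forall>z\<in>Zp. z \<in> qsphere a r \<longrightarrow> has_sph_jet \<Omega> f z (lS (a, r)) (AS (a, r))) \<and>
            (Zp \<inter> qsphere a r = {} \<longrightarrow>
              has_sph_jet \<Omega> f (qreal a + r *\<^sub>R qi) (lS (a, r)) (AS (a, r)))"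
            using 1 2 S(2) by (cases s) auto
        qed (use nX in blast)
      qed
      moreover have "t m holomorphic_on ?D" for m
        unfolding t_def sphere_poly_def by (intro holomorphic_intros)
      ultimately have "good p (Suc (lS (a, r))) t"
        unfolding good_def using S(2) rp[OF S(1)] by auto
      then show ?thesis by blast
    next
      case X
      define t where "t = (\<lambda>(m::4) z. \<Sum>n\<le>lX x. of_real (AX x n $ m) * (z - p) ^ n)"
      have "jets p f" if fit: "fits p (Suc (lX x)) t f" for f
      proof -
        obtain G where G: "slice_rep \<Omega> f G" "\<And>m. G m holomorphic_on ?D"
          "\<And>m. vanishes_to ?D p (Suc (lX x)) (\<lambda>z. G m z - t m z)"
          using fit unfolding fits_def by blast
        have "has_jet f (qreal x) (lX x) (AX x)"
          by (rule has_jet_of_components[OF \<Omega> G(2,1)])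
            (use sub X(1,2) G(3) in \<open>auto simp: sc_real t_def\<close>)
        moreover have "p \<noteq> slice_coord z" if "z \<in> Zp" for z using ImZ[OF that] X(2) by (metis Im_complex_of_real less_irrefl)
        ultimately show ?thesis using X unfolding jets_def by auto
      qed
      moreover have "t m holomorphic_on ?D" for m unfolding t_def by (intro holomorphic_intros)
      moreover have "t m (cnj z) = cnj (t m z)" for m z by (simp add: t_def X(2))
      ultimately have "good p (Suc (lX x)) t" unfolding good_def by blast
      then show ?thesis by blast
    next
      case Z
      define t where "t = (\<lambda>(m::4) z. \<Sum>n\<le>lZ w. of_real (AZ w n $ m) * (z - p) ^ n)"
      have "jets p f" if fit: "fits p (Suc (lZ w)) t f" for f
      proof -
        obtain G where G: "slice_rep \<Omega> f G" "\<And>m. G m holomorphic_on ?D"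
          "\<And>m. vanishes_to ?D p (Suc (lZ w)) (\<lambda>z. G m z - t m z)"
          using fit unfolding fits_def by blast
        have "has_jet f w (lZ w) (AZ w)"
          by (rule has_jet_of_components[OF \<Omega> G(2,1)])
            (use sub Z(1,2) G(3) in \<open>auto simp: t_def\<close>)
        moreover have "p \<noteq> of_real x" for x using ImZ[OF Z(1)] Z(2) by (metis Im_complex_of_real less_irrefl)
        moreover have "z = w" if "z \<in> Zp" "p = slice_coord z" for z
          using same that Z(1,2) by simp
        ultimately show ?thesis using Z(3) unfolding jets_def by blast
      qed
      moreover have "t m holomorphic_on ?D" for m unfolding t_def by (intro holomorphic_intros)
      ultimately have "good p (Suc (lZ w)) t" using ImZ[OF Z(1)] Z(2) unfolding good_def by auto
      then show ?thesis by blast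
    qed
  qed
  then obtain N t where good: "\<And>p. p \<in> P \<Longrightarrow> good p (N p) (t p)" by metis
  obtain f G where f: "slice_regular \<Omega> f" and G: "slice_rep \<Omega> f G" "\<And>m. G m holomorphic_on ?D"
    "\<And>m z. qcx z \<in> \<Omega> \<Longrightarrow> G m (cnj z) = cnj (G m z)"
    "\<And>p m. p \<in> P \<Longrightarrow> vanishes_to ?D p (N p) (\<lambda>z. G m z - t p m z)"
  proof (rule slice_regular_interpolation[OF \<Omega> P ImP, of t N])
    show "t p m holomorphic_on ?D" if "p \<in> P" for p m using good[OF that] by (simp add: good_def)
    show "t p m (cnj z) = cnj (t p m z)" if "p \<in> P" "Im p = 0" for p m z
      using good[OF that(1)] that(2) by (simp add: good_def)
  qed (assumption, rule that, assumption+)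
  have jets: "jets p f" if "p \<in> P" for p
    using good[OF that] G that unfolding good_def fits_def by blast
  have XP: "of_real x \<in> P" if "x \<in> X" for x
    using that sc_real[of x] unfolding P_def W_def by (metis UnI1 UnI2 imageI)
  have SP: "Complex a r \<in> P" if "(a, r) \<in> SS" for a r
    using that sc_qcx[OF that] unfolding P_def W_def by force
  have ZP: "slice_coord z \<in> P" if "z \<in> Zp" for z
    using that by (simp add: P_def W_def)
  have "has_jet f (qreal x) (lX x) (AX x)" if "x \<in> X" for x
    using jets[OF XP[OF that]] that unfolding jets_def by blast
  moreover have "has_jet f z (lZ z) (AZ z)" if "z \<in> Zp" "\<forall>(a, r)\<in>SS. z \<notin> qsphere a r" for z
    using jets[OF ZP[OF that(1)]] that unfolding jets_def by blast
  moreover have "(\<forall>z\<in>Zp. z \<in> qsphere a r \<longrightarrow> has_sph_jet \<Omega> f z (lS (a, r)) (AS (a, r))) \<and>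
      (Zp \<inter> qsphere a r = {} \<longrightarrow> has_sph_jet \<Omega> f (qreal a + r *\<^sub>R qi) (lS (a, r)) (AS (a, r)))"
    if "(a, r) \<in> SS" for a r
    using jets[OF SP[OF that]] that unfolding jets_def by blast
  ultimately show ?thesis using f by (intro exI[of _ f] conjI) blast+
qed

end
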